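(* Let $n\ge1$ be an integer and let $u\in l^2(\mathbb{Z})$. The inequality $$u(0)^2\le\mathrm{K}_{1,n}(\theta)\,\|u\|^{2\theta}\,\|\mathcal{D}^nu\|^{2(1-\theta)}$$ holds for $\theta\in[1-1/(2n),1]$, and its sharp constant is $$\mathrm{K}_{1,n}(\theta)=\frac1{\theta^\theta(1-\theta)^{1-\theta}}\,\frac1\pi\,\sup_{\lambda>0}\;\lambda^\theta\int_0^\pi\frac{dx}{\lambda+2^{2n}\sin^{2n}\frac x2}.$$ For all $\theta\in[1-1/(2n),1]$ the supremum is a maximum. If $n\ge2$, then for $\theta=\theta_*:=1-1/(2n)$ the constants in the continuous and discrete inequalities satisfy $$\mathrm{C}_{1,n}(\theta_* )<\mathrm{K}_{1,n}(\theta_* ).$$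
   Context: Sequences are real-valued. For $u\in l^2(\mathbb{Z})$: $\mathrm{D}u(k)=u(k+1)-u(k)$, $\Delta u(k)=u(k+1)-2u(k)+u(k-1)$, $\|\cdot\|$ is the $l^2$-norm, and $\mathcal{D}^n:=\Delta^{n/2}$ for $n$ even, $\mathcal{D}^n:=\mathrm{D}\,\Delta^{(n-1)/2}$ for $n$ odd. $\mathrm{K}_{1,n}(\theta)$ denotes the sharp (smallest possible) constant in the discrete inequality. Convention: $0^0=1$. $\mathrm{C}_{1,n}(\theta_* )$ is the sharp constant in the continuous inequality $\|f\|_{L_\infty(\mathbb{R})}^2\le\mathrm{C}_{1,n}(\theta_* )\|f\|_{L_2(\mathbb{R})}^{2\theta_*}\|f^{(n)}\|_{L_2(\mathbb{R})}^{2(1-\theta_* )}$ for $f\in H^n(\mathbb{R})$, whose (known) value is $$\mathrm{C}_{1,n}(\theta_* )=\frac1{\theta_*^{\theta_*}(1-\theta_* )^{1-\theta_*}}\,\frac1\pi\int_0^\infty\frac{dx}{1+x^{2n}}=\frac1{\theta_*^{\theta_*}(1-\theta_* )^{1-\theta_*}}\,\frac1{2n\sin\frac\pi{2n}}.$$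
   Formalization: "The supremum is a maximum" fails over λ>0 for θ=1 (V increases strictly to π) and for n=1, θ=1/2 (V=π/√(λ+4)); there the supremum is shown to be the limit as λ→∞, respectively λ→0+; in all other cases it is attained at some λ>0. *)

theory Defs
  imports "HOL-Probability.Essential_Supremum"
begin

(* Power of nonnegative reals with the convention 0^0 = 1; powr itself has 0 powr 0 = 0. *)
definition rpow :: "real \<Rightarrow> real \<Rightarrow> real" where
  "rpow x a = (if x = 0 \<and> a = 0 then 1 else x powr a)"


subsection \<open>The discrete inequality\<close>

definition l2 :: "(int \<Rightarrow> real) set" where
  "l2 = {u. (\<lambda>k. (u k)\<^sup>2) summable_on UNIV}"

definition l2_norm :: "(int \<Rightarrow> real) \<Rightarrow> real" where
  "l2_norm u = sqrt (\<Sum>\<^sub>\<infinity>k. (u k)\<^sup>2)"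

definition fdiff :: "(int \<Rightarrow> real) \<Rightarrow> int \<Rightarrow> real" where
  "fdiff u k = u (k + 1) - u k"

definition laplace :: "(int \<Rightarrow> real) \<Rightarrow> int \<Rightarrow> real" where
  "laplace u k = u (k + 1) - 2 * u k + u (k - 1)"

definition diff_op :: "nat \<Rightarrow> (int \<Rightarrow> real) \<Rightarrow> int \<Rightarrow> real" where
  "diff_op n u = (if even n then (laplace ^^ (n div 2)) u
                  else fdiff ((laplace ^^ ((n - 1) div 2)) u))"

definition discrete_ineq :: "nat \<Rightarrow> real \<Rightarrow> real \<Rightarrow> bool" where
  "discrete_ineq n \<theta> K \<longleftrightarrow>
     (\<forall>u\<in>l2. (u 0)\<^sup>2 \<le> K * rpow (l2_norm u) (2 * \<theta>) * rpow (l2_norm (diff_op n u)) (2 * (1 - \<theta>)))"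

definition K1 :: "nat \<Rightarrow> real \<Rightarrow> real" where
  "K1 n \<theta> = Inf {K. discrete_ineq n \<theta> K}"

(* \<lambda> is reserved syntax, so the parameter lambda of the formula is written \<mu>. *)
definition V :: "nat \<Rightarrow> real \<Rightarrow> real \<Rightarrow> real" where
  "V n \<theta> \<mu> = rpow \<mu> \<theta> * integral {0..pi} (\<lambda>x. 1 / (\<mu> + 2 ^ (2 * n) * sin (x / 2) ^ (2 * n)))"


subsection \<open>The continuous inequality\<close>

(* C^infinity functions with compact support. *)
definition test_fun :: "(real \<Rightarrow> real) \<Rightarrow> bool" where
  "test_fun \<phi> \<longleftrightarrow> (\<forall>k x. (deriv ^^ k) \<phi> field_differentiable at x) \<and> bounded {x. \<phi> x \<noteq> 0}"

definition L2 :: "(real \<Rightarrow> real) set" where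
  "L2 = {f \<in> borel_measurable lborel. integrable lborel (\<lambda>x. (f x)\<^sup>2)}"

definition L2_norm :: "(real \<Rightarrow> real) \<Rightarrow> real" where
  "L2_norm f = sqrt (LINT x|lborel. (f x)\<^sup>2)"

(* For f and g in L2: g represents the k-th distributional derivative of f. *)
definition weak_deriv :: "nat \<Rightarrow> (real \<Rightarrow> real) \<Rightarrow> (real \<Rightarrow> real) \<Rightarrow> bool" where
  "weak_deriv k f g \<longleftrightarrow>
     (\<forall>\<phi>. test_fun \<phi> \<longrightarrow>
        (LINT x|lborel. f x * (deriv ^^ k) \<phi> x) = (-1) ^ k * (LINT x|lborel. g x * \<phi> x))"

definition H :: "nat \<Rightarrow> (real \<Rightarrow> real) set" where
  "H n = {f \<in> L2. \<forall>k\<le>n. \<exists>g\<in>L2. weak_deriv k f g}"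

definition continuous_ineq :: "nat \<Rightarrow> real \<Rightarrow> real \<Rightarrow> bool" where
  "continuous_ineq n \<theta> C \<longleftrightarrow>
     (\<forall>f\<in>H n. \<forall>g\<in>L2. weak_deriv n f g \<longrightarrow>
        (esssup lborel (\<lambda>x. ereal \<bar>f x\<bar>))\<^sup>2
          \<le> ereal (C * rpow (L2_norm f) (2 * \<theta>) * rpow (L2_norm g) (2 * (1 - \<theta>))))"

(* Taken in the extended reals, so that it would be \<infinity> if no constant were admissible. *)
definition C1 :: "nat \<Rightarrow> real \<Rightarrow> ereal" where
  "C1 n \<theta> = Inf (ereal ` {C. continuous_ineq n \<theta> C})"

end

theory Submission
  imports Defs "HOL-Probability.Sinc_Integral"
begin

text \<open>Let \<open>G\<close> be the Green function of \<open>\<mu> + (-\<Delta>)^n\<close>, that is, the cosine coefficients of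
  \<open>1 / (\<pi> (\<mu> + 2^{2n} sin^{2n}(x/2)))\<close>. Pairing \<open>u\<close> with \<open>G\<close> in the form
  \<open>\<mu> (u, v) + (D^n u, D^n v)\<close> gives \<open>u(0)\<close>, so Cauchy--Schwarz yields
  \<open>u(0)^2 \<le> G(0) (\<mu> |u|^2 + |D^n u|^2)\<close> with equality for \<open>u = G\<close>. Optimising over \<open>\<mu>\<close> gives the
  upper bound for the constant; testing with \<open>u = G\<close> and weighted AM--GM gives the lower bound.

  Put \<open>\<theta>\<^sub>* = 1 - 1/(2n)\<close>. Rescaling \<open>x = \<epsilon> s\<close> with \<open>\<mu> = \<epsilon>^{2n}\<close> shows that
  \<open>V\<close> tends to \<open>L = \<integral>\<^sub>0^\<infinity> ds / (1 + s^{2n})\<close> as \<open>\<mu> \<rightarrow> 0\<close> at \<open>\<theta>\<^sub>*\<close>, and for \<open>n \<ge> 2\<close> an expansion in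
  \<open>\<epsilon>\<close> shows that it exceeds \<open>L\<close> somewhere.

  The continuous inequality with the constant corresponding to \<open>L\<close> follows from the discrete one: apply
  the latter to the samples \<open>f(x + h k)\<close>, average over \<open>x\<close> in a window of length \<open>h\<close>, so that the
  \<open>l^2\<close> norms become \<open>L_2\<close> norms, and let \<open>h \<rightarrow> 0\<close> at a Lebesgue point of \<open>f^2\<close>. No Fourier analysis on
  the line is needed.\<close>

subsection \<open>Square summable sequences\<close>

text \<open>\<open>crit n\<close> is the scale-invariant exponent: with
  \<open>\<mu> = e^(2n)\<close> the prefactor of \<open>V\<close> is \<open>\<mu> / e\<close>, which
  cancels the Jacobian of the rescaling. So at \<open>crit n\<close> the limit of \<open>V\<close>
  at \<open>0\<close> is finite and nonzero, while above \<open>crit n\<close> it is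
  \<open>0\<close>. Attainment of the supremum is then a matter of one interior value exceeding both
  end limits. The same invariance explains why sampling produces \<open>L\<close> and not the
  supremum: with step \<open>h\<close> the parameter is \<open>s * h^(2n)\<close>, which tends to
  \<open>0\<close> for each fixed \<open>s\<close>, and \<open>s\<close> remains free for the final
  optimisation. The obstacle on the line is that members of \<open>H n\<close> are known only almost
  everywhere and only through test functions. The required bound, that an \<open>n\<close>-fold
  difference of step \<open>h\<close> has norm at most \<open>h^n\<close> times that of the weak
  derivative, is therefore obtained first for integrals over intervals, by testing with
  moving-window integrals of explicit smooth bumps, and then made pointwise by shrinking the
  intervals.\<close>

definition ip :: "(int \<Rightarrow> real) \<Rightarrow> (int \<Rightarrow> real) \<Rightarrow> real" where
  "ip u v = (\<Sum>\<^sub>\<infinity>k. u k * v k)"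

lemma summable_on_shift:
  fixes u :: "int \<Rightarrow> real"
  shows "(\<lambda>k. u (k + c)) summable_on UNIV \<longleftrightarrow> u summable_on UNIV"
  by (rule summable_on_reindex_bij_betw) (auto intro!: bij_betwI[where g="\<lambda>k. k - c"])

lemma infsum_shift:
  fixes u :: "int \<Rightarrow> real"
  shows "(\<Sum>\<^sub>\<infinity>k. u (k + c)) = (\<Sum>\<^sub>\<infinity>k. u k)"
  by (rule infsum_reindex_bij_betw) (auto intro!: bij_betwI[where g="\<lambda>k. k - c"])

lemma l2_summable: "u \<in> l2 \<Longrightarrow> (\<lambda>k. (u k)\<^sup>2) summable_on UNIV"
  by (simp add: l2_def)

lemma l2_prod_summable:
  assumes "u \<in> l2" "v \<in> l2"
  shows "(\<lambda>k. u k * v k) summable_on UNIV"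
proof -
  have "(\<lambda>k. (u k)\<^sup>2 + (v k)\<^sup>2) summable_on UNIV"
    using assms by (intro summable_on_add l2_summable)
  moreover have "norm (u k * v k) \<le> (u k)\<^sup>2 + (v k)\<^sup>2" for k
  proof -
    have "\<bar>u k\<bar> * \<bar>v k\<bar> \<le> 2 * \<bar>u k\<bar> * \<bar>v k\<bar>" by simp
    also have "\<dots> \<le> (u k)\<^sup>2 + (v k)\<^sup>2"
      using sum_squares_bound[of "\<bar>u k\<bar>" "\<bar>v k\<bar>"] by simp
    finally show ?thesis by (simp add: abs_mult)
  qed
  ultimately have "(\<lambda>k. norm (u k * v k)) summable_on UNIV"
    by (rule summable_on_comparison_test) simp_all
  then show ?thesis
    by (rule abs_summable_summable)
qed

lemma l2_shift: "u \<in> l2 \<Longrightarrow> (\<lambda>k. u (k + c)) \<in> l2"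
  using summable_on_shift[of "\<lambda>k. (u k)\<^sup>2" c] by (simp add: l2_def)

lemma l2_scale: "u \<in> l2 \<Longrightarrow> (\<lambda>k. c * u k) \<in> l2"
  by (simp add: l2_def power_mult_distrib summable_on_cmult_right)

lemma l2_add:
  assumes "u \<in> l2" "v \<in> l2"
  shows "(\<lambda>k. u k + v k) \<in> l2"
proof -
  have "(\<lambda>k. (u k)\<^sup>2 + (v k)\<^sup>2 + 2 * (u k * v k)) summable_on UNIV"
    using assms by (intro summable_on_add l2_summable summable_on_cmult_right l2_prod_summable)
  then show ?thesis
    by (simp add: l2_def power2_sum mult.assoc)
qed

lemma l2_fdiff: "u \<in> l2 \<Longrightarrow> fdiff u \<in> l2"
  using l2_add[OF l2_shift[of u 1] l2_scale[of u "-1"]] by (simp add: fdiff_def[abs_def])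

lemma l2_laplace: "u \<in> l2 \<Longrightarrow> laplace u \<in> l2"
  using l2_add[OF l2_add[OF l2_shift[of u 1] l2_scale[of u "-2"]] l2_shift[of u "-1"]]
  by (simp add: laplace_def[abs_def])

lemma l2_laplace_pow: "u \<in> l2 \<Longrightarrow> (laplace ^^ m) u \<in> l2"
  by (induction m) (auto intro: l2_laplace)

lemma l2_diff_op: "u \<in> l2 \<Longrightarrow> diff_op n u \<in> l2"
  by (simp add: diff_op_def l2_fdiff l2_laplace_pow)

lemma ip_add_left:
  "u \<in> l2 \<Longrightarrow> v \<in> l2 \<Longrightarrow> w \<in> l2 \<Longrightarrow> ip (\<lambda>k. u k + v k) w = ip u w + ip v w"
  unfolding ip_def by (simp add: distrib_right infsum_add l2_prod_summable)

lemma ip_scale_left: "ip (\<lambda>k. c * u k) w = c * ip u w"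
  unfolding ip_def by (simp add: mult.assoc infsum_cmult_right')

lemma ip_commute: "ip u v = ip v u"
  by (simp add: ip_def mult.commute)

lemma ip_shift: "ip (\<lambda>k. u (k + c)) v = ip u (\<lambda>k. v (k - c))"
  using infsum_shift[of "\<lambda>k. u k * v (k - c)" c] by (simp add: ip_def)

lemma ip_laplace_left:
  assumes "u \<in> l2" "v \<in> l2"
  shows "ip (laplace u) v = ip (\<lambda>k. u (k + 1)) v - 2 * ip u v + ip (\<lambda>k. u (k - 1)) v"
proof -
  have "ip (\<lambda>k. (u (k + 1) + (-2) * u k) + u (k + (-1))) v
      = ip (\<lambda>k. u (k + 1)) v + (-2) * ip u v + ip (\<lambda>k. u (k + (-1))) v"
    using assms by (simp only: ip_add_left l2_add l2_scale l2_shift ip_scale_left)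
  then show ?thesis
    by (simp add: laplace_def[abs_def])
qed

lemma ip_laplace_right:
  assumes "u \<in> l2" "v \<in> l2"
  shows "ip u (laplace v) = ip u (\<lambda>k. v (k + 1)) - 2 * ip u v + ip u (\<lambda>k. v (k - 1))"
  unfolding ip_commute[of u] by (rule ip_laplace_left[OF assms(2,1)])

lemma ip_laplace:
  assumes "u \<in> l2" "v \<in> l2"
  shows "ip (laplace u) v = ip u (laplace v)"
  using ip_shift[of u 1 v] ip_shift[of u "-1" v] assms
  by (simp add: ip_laplace_left ip_laplace_right)

lemma ip_fdiff_left:
  assumes "u \<in> l2" "v \<in> l2"
  shows "ip (fdiff u) v = ip (\<lambda>k. u (k + 1)) v - ip u v"
  using ip_add_left[OF l2_shift[of u 1] l2_scale[of u "-1"] assms(2)] assms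
    ip_scale_left[of "-1" u v]
  by (simp add: fdiff_def[abs_def])

text \<open>Summation by parts: the adjoint of the forward difference is minus the backward
  difference, and the composition of the two is \<open>laplace\<close>.\<close>

lemma ip_fdiff:
  assumes "u \<in> l2" "v \<in> l2"
  shows "ip (fdiff u) (fdiff v) = - ip u (laplace v)"
proof -
  have right: "ip w (fdiff v) = ip w (\<lambda>k. v (k + 1)) - ip w v" if "w \<in> l2" for w
    unfolding ip_commute[of w] by (rule ip_fdiff_left[OF assms(2) that])
  have "ip (\<lambda>k. u (k + 1)) (\<lambda>k. v (k + 1)) = ip u v"
    by (simp add: ip_shift)
  then show ?thesis
    using assms ip_shift[of u 1 v]
    by (simp add: ip_fdiff_left l2_fdiff right l2_shift ip_laplace_right)
qed

lemma ip_laplace_pow: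
  "u \<in> l2 \<Longrightarrow> v \<in> l2 \<Longrightarrow> ip ((laplace ^^ m) u) v = ip u ((laplace ^^ m) v)"
proof (induction m arbitrary: v)
  case (Suc m)
  then show ?case
    by (simp add: ip_laplace l2_laplace_pow l2_laplace flip: funpow_swap1)
qed simp

text \<open>Both parities merge into one formula: \<open>laplace\<close> is symmetric, and for odd
  \<open>n\<close> the extra \<open>fdiff\<close> contributes the single minus sign of
  \<open>ip_fdiff\<close>.\<close>

lemma ip_diff_op:
  assumes "u \<in> l2" "v \<in> l2"
  shows "ip (diff_op n u) (diff_op n v) = (-1) ^ n * ip u ((laplace ^^ n) v)"
proof (cases "even n")
  case True
  then obtain m where n: "n = 2 * m" by (auto elim!: evenE)
  have "ip ((laplace ^^ m) u) ((laplace ^^ m) v) = ip u ((laplace ^^ (m + m)) v)"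
    using assms by (simp add: ip_laplace_pow l2_laplace_pow funpow_add)
  then show ?thesis by (simp add: diff_op_def n mult_2)
next
  case False
  then obtain m where n: "n = Suc (2 * m)" by (auto elim!: oddE)
  have "ip ((laplace ^^ m) u) (laplace ((laplace ^^ m) v)) = ip u ((laplace ^^ (m + Suc m)) v)"
    using assms by (simp only: ip_laplace_pow l2_laplace l2_laplace_pow funpow_add o_apply funpow.simps)
  then show ?thesis
    using assms by (simp only: diff_op_def n) (simp add: ip_fdiff l2_laplace_pow mult_2)
qed

lemma ip_self_nonneg: "0 \<le> ip u u"
  unfolding ip_def by (intro infsum_nonneg) auto

lemma ip_self_expand:
  assumes "u \<in> l2" "v \<in> l2"
  shows "ip (\<lambda>k. u k + t * v k) (\<lambda>k. u k + t * v k) = ip u u + 2 * t * ip u v + t\<^sup>2 * ip v v"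
proof -
  let ?w = "\<lambda>k. u k + t * v k"
  have *: "ip ?w w = ip u w + t * ip v w" if "w \<in> l2" for w
    using that assms by (simp add: ip_add_left l2_scale ip_scale_left)
  have "ip ?w ?w = ip u ?w + t * ip v ?w"
    using assms by (intro * l2_add l2_scale)
  also have "ip u ?w = ip u u + t * ip v u"
    using assms(1) by (subst ip_commute) (rule *)
  also have "ip v ?w = ip u v + t * ip v v"
    using assms(2) by (subst ip_commute) (rule *)
  also have "ip v u = ip u v"
    by (rule ip_commute)
  finally show ?thesis
    by (simp add: algebra_simps power2_eq_square)
qed

lemma ip_self_ge:
  assumes "u \<in> l2"
  shows "(u k)\<^sup>2 \<le> ip u u"
proof -
  have "(\<Sum>j\<in>{k}. u j * u j) \<le> ip u u"
    unfolding ip_def using l2_prod_summable[OF assms assms]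
    by (intro finite_sum_le_infsum) auto
  then show ?thesis by (simp add: power2_eq_square)
qed

subsection \<open>The Green function\<close>

text \<open>The Fourier symbol of \<open>(-laplace)^n\<close>, in the form in which it occurs in
  \<open>V\<close>.\<close>

definition symb :: "nat \<Rightarrow> real \<Rightarrow> real" where
  "symb n x = 2 ^ (2 * n) * sin (x / 2) ^ (2 * n)"

definition Ig :: "nat \<Rightarrow> real \<Rightarrow> real" where
  "Ig n \<mu> = integral {0..pi} (\<lambda>x. 1 / (\<mu> + symb n x))"

text \<open>This is \<open>pi\<close> times the \<open>k\<close>-th Fourier coefficient of the even
  extension of \<open>w\<close>, which is why the weight of \<open>green\<close> carries a factor
  \<open>1 / pi\<close>.\<close>

definition coscoeff :: "(real \<Rightarrow> real) \<Rightarrow> int \<Rightarrow> real" where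
  "coscoeff w k = integral {0..pi} (\<lambda>x. cos (k * x) * w x)"

lemma symb_alt: "symb n x = (2 - 2 * cos x) ^ n"
proof -
  have "2 - 2 * cos x = 4 * (sin (x / 2))\<^sup>2"
    using cos_double_sin[of "x / 2"] by simp
  then show ?thesis
    by (simp add: symb_def power_mult power_mult_distrib)
qed

lemma symb_nonneg: "0 \<le> symb n x"
  by (simp add: symb_alt)

lemma continuous_symb [continuous_intros]: "continuous_on S (symb n)"
  unfolding symb_def by (intro continuous_intros) auto

text \<open>The addition formula \<open>cos ((k+1) x) + cos ((k-1) x) = 2 cos (k x) cos x\<close>
  turns the second difference in \<open>k\<close> into multiplication of the weight.\<close>

lemma coscoeff_laplace:
  assumes "continuous_on {0..pi} w"
  shows "laplace (coscoeff w) k = coscoeff (\<lambda>x. - (2 - 2 * cos x) * w x) k"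
proof -
  have hi: "((\<lambda>x. cos (real_of_int j * x) * w x) has_integral coscoeff w j) {0..pi}" for j
    unfolding coscoeff_def has_integral_integral[symmetric]
    using assms by (intro integrable_continuous_real continuous_intros)
  have "((\<lambda>x. cos (real_of_int (k+1) * x) * w x - 2 * (cos (real_of_int k * x) * w x)
         + cos (real_of_int (k-1) * x) * w x) has_integral laplace (coscoeff w) k) {0..pi}"
    unfolding laplace_def by (intro has_integral_add has_integral_diff has_integral_mult_right hi)
  moreover have "(\<lambda>x. cos (real_of_int (k+1) * x) * w x - 2 * (cos (real_of_int k * x) * w x)
         + cos (real_of_int (k-1) * x) * w x)
      = (\<lambda>x. cos (real_of_int k * x) * (- (2 - 2 * cos x) * w x))"
    by (auto simp: algebra_simps cos_add cos_diff)
  ultimately show ?thesis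
    by (simp only: has_integral_iff coscoeff_def[of "\<lambda>x. - (2 - 2 * cos x) * w x"])
qed

lemma coscoeff_laplace_pow:
  assumes "continuous_on {0..pi} w"
  shows "(laplace ^^ m) (coscoeff w) = coscoeff (\<lambda>x. (-1) ^ m * symb m x * w x)"
proof (induction m)
  case 0
  show ?case by (simp add: symb_alt)
next
  case (Suc m)
  have "(laplace ^^ Suc m) (coscoeff w) k = coscoeff (\<lambda>x. (-1) ^ Suc m * symb (Suc m) x * w x) k" for k
  proof -
    have "(laplace ^^ Suc m) (coscoeff w) k = laplace (coscoeff (\<lambda>x. (-1) ^ m * symb m x * w x)) k"
      using Suc by simp
    also have "\<dots> = coscoeff (\<lambda>x. - (2 - 2 * cos x) * ((-1) ^ m * symb m x * w x)) k"
      by (intro coscoeff_laplace continuous_intros assms)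
    also have "(\<lambda>x. - (2 - 2 * cos x) * ((-1) ^ m * symb m x * w x))
        = (\<lambda>x. (-1) ^ Suc m * symb (Suc m) x * w x)"
      by (simp add: symb_alt fun_eq_iff algebra_simps)
    finally show ?thesis .
  qed
  then show ?case by (rule ext)
qed

section \<open>Orthogonality of the cosines and Bessel's inequality\<close>

lemma coscoeff_1: "coscoeff (\<lambda>_. 1) k = (if k = 0 then pi else 0)"
proof (cases "k = 0")
  case False
  have "((\<lambda>x. cos (k * x)) has_integral (sin (real_of_int k * pi) / k - sin (real_of_int k * 0)
      / k)) {0..pi}"
    using False
    by (intro fundamental_theorem_of_calculus)
       (auto intro!: derivative_eq_intros simp: has_real_derivative_iff_has_vector_derivative[symmetric])
  then show ?thesis
    using False sin_npi_int[of k] by (simp add: coscoeff_def has_integral_iff mult.commute)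
qed (simp add: coscoeff_def)

text \<open>Frequencies of either sign are allowed, so both \<open>j = k\<close> and
  \<open>j = - k\<close> count; they coincide exactly at \<open>0\<close>, where the value doubles
  to \<open>pi\<close>.\<close>

lemma integral_cos_cos:
  "integral {0..pi} (\<lambda>x. cos (real_of_int j * x) * cos (real_of_int k * x))
     = pi / 2 * ((if j = k then 1 else 0) + (if j = - k then 1 else 0))"
proof -
  have int: "(\<lambda>x. cos (real_of_int j * x)) integrable_on {0..pi}" for j
    by (intro integrable_continuous_real continuous_intros)
  have "integral {0..pi} (\<lambda>x. cos (real_of_int j * x) * cos (real_of_int k * x))
      = integral {0..pi} (\<lambda>x. 1/2 * (cos (real_of_int (j - k) * x) + cos (real_of_int (j + k) * x)))"
    by (rule arg_cong[where f="integral _"]) (auto simp: algebra_simps cos_add cos_diff)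
  also have "\<dots> = 1/2 * (coscoeff (\<lambda>_. 1) (j - k) + coscoeff (\<lambda>_. 1) (j + k))"
    unfolding coscoeff_def
    by (subst integral_mult_right, subst integral_add) (auto intro: int simp del: of_int_diff of_int_add)
  finally show ?thesis
    by (auto simp: coscoeff_1)
qed

text \<open>In this form of Bessel's inequality the cosine polynomial is summed symmetrically over positive and
  negative frequencies so that no frequency needs special treatment.\<close>

lemma coscoeff_l2:
  assumes w: "continuous_on {0..pi} w"
  shows "coscoeff w \<in> l2"
proof -
  define I where "I = integral {0..pi} (\<lambda>x. (w x)\<^sup>2)"
  have sym: "coscoeff w (-k) = coscoeff w k" for k
    by (simp add: coscoeff_def)
  have fin: "(\<Sum>k\<in>{-N..N}. (coscoeff w k)\<^sup>2) \<le> pi * I" for N :: int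
  proof -
    define A where "A = {-N..N}"
    define c where "c k = coscoeff w k / pi" for k
    \<comment> \<open>The Fourier partial sum of the even extension of \<open>w\<close>. Pairing it
      with \<open>w\<close> and with itself gives the same value, so the integral of
      \<open>(w - P)^2\<close> is \<open>I\<close> minus that value.\<close>
    define P where "P x = (\<Sum>k\<in>A. c k * cos (real_of_int k * x))" for x :: real
    have csym: "c (-k) = c k" for k by (simp add: c_def sym)
    have contP: "continuous_on {0..pi} P"
      unfolding P_def by (intro continuous_intros)
    have 1: "integral {0..pi} (\<lambda>x. P x * w x) = pi * (\<Sum>k\<in>A. (c k)\<^sup>2)"
    proof -
      have "integral {0..pi} (\<lambda>x. P x * w x) = integral {0..pi} (\<lambda>x. \<Sum>k\<in>A. c k * (cos (k * x) * w x))"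
        by (simp add: P_def sum_distrib_right mult.assoc)
      also have "\<dots> = (\<Sum>k\<in>A. c k * coscoeff w k)"
        unfolding coscoeff_def
        by (subst integral_sum) (auto simp: A_def intro!: integrable_continuous_real continuous_intros w)
      finally show ?thesis by (simp add: c_def sum_distrib_left power2_eq_square)
    qed
    have 2: "integral {0..pi} (\<lambda>x. (P x)\<^sup>2) = pi * (\<Sum>k\<in>A. (c k)\<^sup>2)"
    proof -
      have "integral {0..pi} (\<lambda>x. (P x)\<^sup>2)
          = integral {0..pi} (\<lambda>x. \<Sum>j\<in>A. \<Sum>k\<in>A. c j * c k * (cos (j * x) * cos (k * x)))"
        by (simp add: P_def power2_eq_square sum_product mult_ac)
      also have "\<dots> = (\<Sum>j\<in>A. \<Sum>k\<in>A. c j * c k * integral {0..pi} (\<lambda>x. cos (j * x) * cos (k * x)))"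
        by (subst integral_sum; (subst integral_sum)?)
          (auto simp: A_def intro!: integrable_continuous_real continuous_intros)
      also have "\<dots> = (\<Sum>j\<in>A. pi * (c j)\<^sup>2)"
      proof (rule sum.cong[OF refl])
        \<comment> \<open>The row of \<open>j\<close> has two nonzero entries, at \<open>j\<close>
          and at \<open>-j\<close>; both lie in the symmetric range \<open>A\<close> and are equal
          because \<open>c\<close> is even. For \<open>j = 0\<close> the two indicators fall on one
          entry.\<close>
        fix j assume j: "j \<in> A"
        then have j': "- j \<in> A" by (auto simp: A_def)
        have "(\<Sum>k\<in>A. c j * c k * integral {0..pi} (\<lambda>x. cos (j * x) * cos (k * x)))
            = (\<Sum>k\<in>A. pi / 2 * (if j = k then c j * c k else 0) + pi / 2 * (if -j
                = k then c j * c k else 0))"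
          unfolding integral_cos_cos by (rule sum.cong[OF refl]) auto
        also have "\<dots> = pi / 2 * (c j * c j) + pi / 2 * (c j * c (-j))"
          unfolding sum.distrib sum_distrib_left[symmetric] using j j'
          by (simp add: A_def sum.delta' del: atLeastAtMost_iff)
        finally show "(\<Sum>k\<in>A. c j * c k * integral {0..pi} (\<lambda>x. cos (j * x) * cos (k * x)))
            = pi * (c j)\<^sup>2"
          by (simp add: csym power2_eq_square)
      qed
      finally show ?thesis by (simp add: sum_distrib_left)
    qed
    have hi: "((\<lambda>x. (w x)\<^sup>2 - 2 * (P x * w x) + (P x)\<^sup>2) has_integral
        (I - 2 * integral {0..pi} (\<lambda>x. P x * w x) + integral {0..pi} (\<lambda>x. (P x)\<^sup>2))) {0..pi}"
      unfolding I_def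
      by (intro has_integral_add has_integral_diff has_integral_mult_right integrable_integral
          integrable_continuous_real continuous_intros w contP)
    have "0 \<le> integral {0..pi} (\<lambda>x. (w x - P x)\<^sup>2)"
      by (intro integral_nonneg integrable_continuous_real continuous_intros w contP) auto
    also have "\<dots> = integral {0..pi} (\<lambda>x. (w x)\<^sup>2 - 2 * (P x * w x) + (P x)\<^sup>2)"
      by (rule arg_cong[where f="integral _"]) (auto simp: power2_eq_square algebra_simps)
    also note integral_unique[OF hi]
    finally have "pi * (\<Sum>k\<in>A. (c k)\<^sup>2) \<le> I"
      by (simp add: 1 2)
    then have "pi * (pi * (\<Sum>k\<in>A. (c k)\<^sup>2)) \<le> pi * I"
      by (rule mult_left_mono) simp
    moreover have "pi * (pi * (\<Sum>k\<in>A. (c k)\<^sup>2)) = (\<Sum>k\<in>A. (coscoeff w k)\<^sup>2)"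
      by (simp add: c_def sum_distrib_left power2_eq_square)
    ultimately show ?thesis unfolding A_def by linarith
  qed
  have "sum (\<lambda>k. (coscoeff w k)\<^sup>2) F \<le> pi * I" if "finite F" for F :: "int set"
  proof -
    define N where "N = Max (insert 0 (abs ` F))"
    have "F \<subseteq> {-N..N}"
    proof
      fix k assume "k \<in> F"
      then have "\<bar>k\<bar> \<le> N" unfolding N_def using that by (intro Max_ge) auto
      then show "k \<in> {-N..N}" by auto
    qed
    then have "sum (\<lambda>k. (coscoeff w k)\<^sup>2) F \<le> (\<Sum>k\<in>{-N..N}. (coscoeff w k)\<^sup>2)"
      by (intro sum_mono2) auto
    then show ?thesis using fin[of N] by linarith
  qed
  then have "(\<lambda>k. (coscoeff w k)\<^sup>2) summable_on UNIV"
    by (intro nonneg_bdd_above_summable_on) (auto intro!: bdd_aboveI)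
  then show ?thesis by (simp add: l2_def)
qed

definition green :: "nat \<Rightarrow> real \<Rightarrow> int \<Rightarrow> real" where
  "green n \<mu> = coscoeff (\<lambda>x. 1 / (pi * (\<mu> + symb n x)))"

lemma symb_pos: "\<mu> > 0 \<Longrightarrow> \<mu> + symb n x > 0"
  using symb_nonneg[of n x] by linarith

lemma continuous_green_weight:
  assumes "\<mu> > 0"
  shows "continuous_on S (\<lambda>x. 1 / (pi * (\<mu> + symb n x)))"
  using symb_pos[OF assms, of n] by (intro continuous_intros) (metis less_irrefl mult_eq_0_iff
      pi_neq_zero)

lemma green_l2: "\<mu> > 0 \<Longrightarrow> green n \<mu> \<in> l2"
  unfolding green_def by (intro coscoeff_l2 continuous_green_weight)

lemma green_0: "green n \<mu> 0 = Ig n \<mu> / pi"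
proof -
  have "(\<lambda>x. 1 / (pi * (\<mu> + symb n x))) = (\<lambda>x. 1 / (\<mu> + symb n x) / pi)" by auto
  then show ?thesis
    unfolding green_def coscoeff_def Ig_def
        by (simp only: of_int_0 mult_zero_left cos_zero mult_1 integral_divide)
qed

text \<open>The operator multiplies the weight by \<open>\<mu> + symb n x\<close>, which cancels the
  denominator and leaves the cosine coefficients of the constant \<open>1 / pi\<close>.\<close>

lemma green_equation:
  assumes "\<mu> > 0"
  shows "\<mu> * green n \<mu> k + (-1) ^ n * (laplace ^^ n) (green n \<mu>) k = (if k = 0 then 1 else 0)"
proof -
  let ?w = "\<lambda>x. 1 / (pi * (\<mu> + symb n x))"
  have w: "continuous_on S ?w" for S
    by (rule continuous_green_weight[OF assms])
  have nz: "\<mu> + symb n x \<noteq> 0" for x using symb_pos[OF assms, of n x] by simp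
  have 1: "((\<lambda>x. cos (k * x) * ?w x) has_integral green n \<mu> k) {0..pi}"
    unfolding green_def coscoeff_def
    by (intro integrable_integral integrable_continuous_real continuous_on_mult w continuous_intros)
  have 2: "((\<lambda>x. cos (k * x) * ((-1) ^ n * symb n x * ?w x))
      has_integral (laplace ^^ n) (green n \<mu>) k) {0..pi}"
    unfolding green_def coscoeff_laplace_pow[OF w] unfolding coscoeff_def
    by (intro integrable_integral integrable_continuous_real continuous_on_mult w continuous_intros)
  have "((\<lambda>x. \<mu> * (cos (k * x) * ?w x) + (-1) ^ n * (cos (k * x) * ((-1) ^ n * symb n x * ?w x)))
      has_integral (\<mu> * green n \<mu> k + (-1) ^ n * (laplace ^^ n) (green n \<mu>) k)) {0..pi}"
    by (intro has_integral_add has_integral_mult_right 1 2)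
  moreover have "\<mu> * (cos (k * x) * ?w x) + (-1) ^ n * (cos (k * x) * ((-1) ^ n * symb n x * ?w x))
      = cos (k * x) * 1 / pi" for x :: real
  proof -
    have "(-1) ^ n * (cos (k * x) * ((-1) ^ n * symb n x * ?w x))
        = ((-1) ^ n * (-1) ^ n) * (cos (k * x) * (symb n x * ?w x))"
      by (simp only: mult_ac)
    also have "\<dots> = cos (k * x) * (symb n x * ?w x)"
      by (simp flip: power_mult_distrib)
    finally show ?thesis
      using nz[of x] by (simp add: divide_simps) (simp add: algebra_simps)
  qed
  ultimately have "\<mu> * green n \<mu> k + (-1) ^ n * (laplace ^^ n) (green n \<mu>) k = coscoeff (\<lambda>_. 1) k / pi"
    by (simp add: has_integral_iff coscoeff_def)
  then show ?thesis by (auto simp: coscoeff_1)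
qed

text \<open>All differences are moved onto the Green function by \<open>ip_diff_op\<close>; what
  remains is the pairing of \<open>u\<close> with the unit mass at \<open>0\<close>.\<close>

lemma green_pairing:
  assumes "\<mu> > 0" "u \<in> l2"
  shows "\<mu> * ip u (green n \<mu>) + ip (diff_op n u) (diff_op n (green n \<mu>)) = u 0"
proof -
  let ?G = "green n \<mu>"
  have G: "?G \<in> l2" using assms by (simp add: green_l2)
  have "\<mu> * ip u ?G + ip (diff_op n u) (diff_op n ?G)
      = ip (\<lambda>k. \<mu> * ?G k + (-1) ^ n * (laplace ^^ n) ?G k) u"
    using assms G
    by (simp add: ip_diff_op ip_add_left l2_scale l2_laplace_pow ip_scale_left ip_commute[of u])
  also have "\<dots> = (\<Sum>\<^sub>\<infinity>k. (if k = 0 then 1 else 0) * u k)"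
    by (simp only: ip_def green_equation[OF assms(1)])
  also have "\<dots> = (\<Sum>\<^sub>\<infinity>k\<in>{0}. (if k = 0 then 1 else 0) * u k)"
    by (rule infsum_cong_neutral) auto
  finally show ?thesis by simp
qed

lemma Ig_pos:
  assumes "\<mu> > 0"
  shows "Ig n \<mu> > 0"
proof -
  have c: "continuous_on {0..pi} (\<lambda>x. 1 / (\<mu> + symb n x))"
    using symb_pos[OF assms, of n] by (intro continuous_intros) (metis less_irrefl)
  have *: "1 / (\<mu> + symb n x) > 0" for x using symb_pos[OF assms] by simp
  have "integral {0..pi} (\<lambda>x. 1 / (\<mu> + symb n x)) \<noteq> 0"
    using * integral_eq_0_iff[OF c pi_gt_zero less_imp_le[OF *]]
    by (metis atLeastAtMost_iff less_irrefl order_refl pi_ge_zero)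
  moreover have "0 \<le> integral {0..pi} (\<lambda>x. 1 / (\<mu> + symb n x))"
    using * by (intro integral_nonneg integrable_continuous_real c) (auto intro: less_imp_le)
  ultimately show ?thesis by (simp add: Ig_def)
qed

lemma discrete_quadratic_ineq:
  assumes "\<mu> > 0" "u \<in> l2"
  shows "(u 0)\<^sup>2 \<le> Ig n \<mu> / pi * (\<mu> * ip u u + ip (diff_op n u) (diff_op n u))"
proof -
  let ?G = "green n \<mu>" and ?D = "diff_op n"
  define g where "g = ?G 0"
  have gpos: "g > 0" using Ig_pos[OF assms(1), of n] by (simp add: g_def green_0)
  have G: "?G \<in> l2" using assms by (simp add: green_l2)
  \<comment> \<open>The minimiser in \<open>t\<close> of the energy of \<open>u + t * ?G\<close>. By
    \<open>green_pairing\<close> this energy is a quadratic polynomial with linear coefficient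
    \<open>2 * u 0\<close> and leading coefficient \<open>g\<close>, so its nonnegativity is the
    Cauchy-Schwarz inequality.\<close>
  define t where "t = - u 0 / g"
  have "0 \<le> \<mu> * ip (\<lambda>k. u k + t * ?G k) (\<lambda>k. u k + t * ?G k)
      + ip (\<lambda>k. ?D u k + t * ?D ?G k) (\<lambda>k. ?D u k + t * ?D ?G k)"
    using assms by (simp add: ip_self_nonneg)
  also have "\<dots> = (\<mu> * ip u u + ip (?D u) (?D u)) + 2 * t * (\<mu> * ip u ?G + ip (?D u) (?D ?G))
       + t\<^sup>2 * (\<mu> * ip ?G ?G + ip (?D ?G) (?D ?G))"
    using assms G by (simp add: ip_self_expand l2_diff_op algebra_simps)
  also have "\<dots> = (\<mu> * ip u u + ip (?D u) (?D u)) + 2 * t * u 0 + t\<^sup>2 * g"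
    using assms G by (simp add: green_pairing g_def)
  also have "\<dots> = (\<mu> * ip u u + ip (?D u) (?D u)) - (u 0)\<^sup>2 / g"
    using gpos by (simp add: t_def field_simps power2_eq_square)
  finally have "(u 0)\<^sup>2 \<le> g * (\<mu> * ip u u + ip (?D u) (?D u))"
    using gpos by (simp add: field_simps)
  then show ?thesis by (simp add: g_def green_0)
qed

subsection \<open>The formula for the discrete constant\<close>

lemma rpow_nonneg [simp]: "0 \<le> rpow x a"
  by (simp add: rpow_def)

lemma rpow_eq_powr: "x \<noteq> 0 \<Longrightarrow> rpow x a = x powr a"
  by (simp add: rpow_def)

lemma rpow_sqrt:
  assumes "0 \<le> x"
  shows "rpow (sqrt x) (2 * a) = rpow x a"
  using assms by (auto simp: rpow_def powr_half_sqrt[symmetric] powr_powr)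

text \<open>Weighted AM-GM for \<open>\<mu> * a / \<theta>\<close> and
  \<open>b / (1 - \<theta>)\<close> with weights \<open>\<theta>\<close> and
  \<open>1 - \<theta>\<close>. At \<open>\<theta> = 1\<close> the convention for \<open>0^0\<close>
  makes the factors with exponent \<open>1 - \<theta>\<close> equal to \<open>1\<close>.\<close>

lemma rpow_weighted_mean:
  assumes "0 < \<theta>" "\<theta> \<le> 1" "\<mu> > 0" "0 \<le> a" "0 \<le> b"
  shows "rpow \<mu> \<theta> * (rpow a \<theta> * rpow b (1 - \<theta>))
       \<le> rpow \<theta> \<theta> * rpow (1 - \<theta>) (1 - \<theta>) * (\<mu> * a + b)"
proof -
  consider "\<theta> = 1" | "\<theta> < 1" "a = 0 \<or> b = 0" | "\<theta> < 1" "a > 0" "b > 0"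
    using assms by fastforce
  then show ?thesis
  proof cases
    case 1
    then show ?thesis using assms by (simp add: rpow_def)
  next
    case 2
    then have "rpow \<mu> \<theta> * (rpow a \<theta> * rpow b (1 - \<theta>)) = 0"
      using assms by (auto simp: rpow_def)
    moreover have "0 \<le> rpow \<theta> \<theta> * rpow (1 - \<theta>) (1 - \<theta>) * (\<mu> * a + b)"
      using assms by (intro mult_nonneg_nonneg add_nonneg_nonneg) auto
    ultimately show ?thesis by (simp only:)
  next
    case 3
    have "(\<mu> * a / \<theta>) powr \<theta> * (b / (1 - \<theta>)) powr (1 - \<theta>)
        \<le> \<theta> * (\<mu> * a / \<theta>) + (1 - \<theta>) * (b / (1 - \<theta>))"
      using assms 3 by (intro Youngs_inequality_0) auto
    also have "\<dots> = \<mu> * a + b"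
      using assms 3 by simp
    finally have "(\<mu> powr \<theta> * a powr \<theta> / \<theta> powr \<theta>) * (b powr (1 - \<theta>) / (1 - \<theta>) powr (1 - \<theta>)) \<le> \<mu> * a + b"
      using assms 3 by (simp add: powr_mult powr_divide)
    then have "\<mu> powr \<theta> * a powr \<theta> * b powr (1 - \<theta>) \<le> (\<mu> * a + b) * (\<theta> powr \<theta> * (1 - \<theta>) powr (1 - \<theta>))"
      using assms 3 by (simp add: field_simps)
    then show ?thesis
      using assms 3 by (simp add: rpow_eq_powr mult_ac)
  qed
qed

text \<open>The converse of \<open>rpow_weighted_mean\<close>: a family of additive bounds, one for
  each scale \<open>s\<close>, collapses to the multiplicative bound at the best scale. It serves
  both the discrete and the continuous inequality.\<close>

lemma optimise_scale:
  assumes \<theta>: "0 < \<theta>" "\<theta> < 1" and "0 \<le> a" "0 \<le> b"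
    and X: "\<And>s. s > 0 \<Longrightarrow> X \<le> c * (s powr (1 - \<theta>) * a + s powr (- \<theta>) * b)"
  shows "X \<le> c / (rpow \<theta> \<theta> * rpow (1 - \<theta>) (1 - \<theta>)) * rpow a \<theta> * rpow b (1 - \<theta>)"
proof -
  consider "a = 0" | "b = 0" | "a > 0" "b > 0"
    using assms by fastforce
  then show ?thesis
  proof cases
    \<comment> \<open>If \<open>a\<close> or \<open>b\<close> vanishes, the infimum over
      \<open>s\<close> may only be approached: as \<open>s\<close> tends to infinity for
      \<open>a = 0\<close>, and as \<open>s\<close> tends to \<open>0\<close> for
      \<open>b = 0\<close>. The bound obtained is \<open>0\<close>, as is the right-hand
      side.\<close>
    case 1
    have "((\<lambda>s. c * (s powr (1 - \<theta>) * a + s powr (- \<theta>) * b)) \<longlongrightarrow> c * (0 + 0 * b)) at_top"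
      using \<theta> unfolding 1 by (intro tendsto_intros tendsto_neg_powr filterlim_ident) auto
    then have "X \<le> c * (0 + 0 * b)"
      by (rule tendsto_lowerbound) (auto intro!: eventually_mono[OF eventually_gt_at_top[of 0]] X)
    then show ?thesis using 1 \<theta> by (simp add: rpow_def)
  next
    case 2
    have "((\<lambda>s. c * (s powr (1 - \<theta>) * a + s powr (- \<theta>) * b))
        \<longlongrightarrow> c * (0 powr (1 - \<theta>) * a + 0)) (at_right 0)"
      using \<theta> unfolding 2
      by (intro tendsto_intros tendsto_powr' tendsto_mult_right) (auto intro: eventually_mono[OF
          eventually_at_right_less])
    then have "X \<le> c * (0 powr (1 - \<theta>) * a + 0)"
      by (rule tendsto_lowerbound) (auto intro!: eventually_mono[OF eventually_at_right_less] X)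
    then show ?thesis using 2 \<theta> by (simp add: rpow_def)
  next
    case 3
    \<comment> \<open>The stationary point of
      \<open>s powr (1 - \<theta>) * a + s powr (- \<theta>) * b\<close>.\<close>
    define s where "s = (\<theta> / (1 - \<theta>)) * (b / a)"
    define p q A B where "p = \<theta> powr \<theta>" and "q = (1 - \<theta>) powr \<theta>" and "A = a powr \<theta>" and "B = b powr \<theta>"
    have pos: "p > 0" "q > 0" "A > 0" "B > 0" "s > 0"
      using \<theta> 3 by (auto simp: p_def q_def A_def B_def s_def)
    have s\<theta>: "s powr (- \<theta>) = q * A / (p * B)"
      using \<theta> 3
      by (simp add: s_def powr_mult powr_divide powr_minus p_def q_def A_def B_def divide_simps
          del: right_diff_distrib left_diff_distrib)
    have "s powr (1 - \<theta>) = s * s powr (- \<theta>)"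
      using pos by (simp add: powr_diff powr_minus field_simps)
    then have "s powr (1 - \<theta>) * a + s powr (- \<theta>) * b = (s * a + b) * s powr (- \<theta>)"
      by (simp add: algebra_simps)
    also have "s * a + b = b / (1 - \<theta>)"
      using 3 \<theta> by (simp add: s_def field_simps)
    finally have eq: "s powr (1 - \<theta>) * a + s powr (- \<theta>) * b = b / (1 - \<theta>) * (q * A / (p * B))"
      by (simp only: s\<theta>)
    have rw: "rpow (1 - \<theta>) (1 - \<theta>) = (1 - \<theta>) / q" "rpow b (1 - \<theta>) = b / B" "rpow \<theta> \<theta> = p" "rpow a \<theta> = A"
      using \<theta> 3 by (simp_all add: rpow_eq_powr powr_diff p_def q_def A_def B_def)
    have "c / (rpow \<theta> \<theta> * rpow (1 - \<theta>) (1 - \<theta>)) * rpow a \<theta> * rpow b (1 - \<theta>)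
        = c * (b / (1 - \<theta>) * (q * A / (p * B)))"
      unfolding rw by (simp add: mult_ac)
    then show ?thesis
      using X[OF pos(5)] unfolding eq by simp
  qed
qed

text \<open>The prefactor common to the discrete and the continuous constant; at
  \<open>\<theta> = 1\<close> it is \<open>1 / pi\<close>.\<close>

definition Kfac :: "real \<Rightarrow> real" where
  "Kfac \<theta> = 1 / (rpow \<theta> \<theta> * rpow (1 - \<theta>) (1 - \<theta>)) * (1 / pi)"

lemma Kfac_pos:
  assumes "0 < \<theta>" "\<theta> \<le> 1"
  shows "Kfac \<theta> > 0"
proof -
  have "rpow \<theta> \<theta> > 0" "rpow (1 - \<theta>) (1 - \<theta>) > 0"
    using assms by (auto simp: rpow_def)
  then show ?thesis by (simp add: Kfac_def)
qed

lemma V_eq: "V n \<theta> \<mu> = rpow \<mu> \<theta> * Ig n \<mu>"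
  by (simp add: V_def Ig_def symb_def)

lemma rpow_l2_norm: "rpow (l2_norm u) (2 * a) = rpow (ip u u) a"
  using rpow_sqrt[OF ip_self_nonneg, of u a] by (simp add: l2_norm_def ip_def power2_eq_square)

lemma discrete_ineq_iff:
  "discrete_ineq n \<theta> K \<longleftrightarrow>
     (\<forall>u\<in>l2. (u 0)\<^sup>2 \<le> K * rpow (ip u u) \<theta> * rpow (ip (diff_op n u) (diff_op n u)) (1 - \<theta>))"
  by (simp only: discrete_ineq_def rpow_l2_norm)

text \<open>The energy of the Green function equals its value \<open>g\<close> at \<open>0\<close>.
  AM-GM therefore bounds the product of its norms by a multiple of \<open>g\<close>, and one factor
  of \<open>g^2\<close> cancels. Since this works for each \<open>\<mu>\<close> separately, the
  bound passes to the supremum whether or not it is attained.\<close>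

lemma discrete_ineq_lower:
  assumes "discrete_ineq n \<theta> K" and \<theta>: "0 < \<theta>" "\<theta> \<le> 1" and "\<mu> > 0"
  shows "Kfac \<theta> * V n \<theta> \<mu> \<le> K"
proof -
  let ?G = "green n \<mu>" and ?D = "diff_op n"
  define a b g where "a = ip ?G ?G" and "b = ip (?D ?G) (?D ?G)" and "g = ?G 0"
  define R where "R = rpow \<theta> \<theta> * rpow (1 - \<theta>) (1 - \<theta>)"
  have R: "R > 0" using \<theta> by (auto simp: R_def rpow_def)
  have g: "g > 0" "g = Ig n \<mu> / pi"
    using Ig_pos[OF \<open>\<mu> > 0\<close>, of n] by (simp_all add: g_def green_0)
  have ab: "\<mu> * a + b = g" "0 \<le> a" "0 \<le> b"
    using green_pairing[OF \<open>\<mu> > 0\<close> green_l2[OF \<open>\<mu> > 0\<close>], of n]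
    by (simp_all add: a_def b_def g_def ip_self_nonneg)
  have *: "g\<^sup>2 \<le> K * (rpow a \<theta> * rpow b (1 - \<theta>))"
    using assms(1) green_l2[OF \<open>\<mu> > 0\<close>, of n]
    by (simp add: discrete_ineq_iff a_def b_def g_def mult.assoc)
  \<comment> \<open>The sign of \<open>K\<close> is needed to multiply the AM-GM bound by it; it
    follows from \<open>g > 0\<close>.\<close>
  have "K \<ge> 0"
  proof (rule ccontr)
    assume "\<not> 0 \<le> K"
    then have "K * (rpow a \<theta> * rpow b (1 - \<theta>)) \<le> 0"
      by (intro mult_nonpos_nonneg) auto
    then show False using * g by (smt (verit) zero_less_power)
  qed
  have "rpow \<mu> \<theta> * g\<^sup>2 \<le> rpow \<mu> \<theta> * (K * (rpow a \<theta> * rpow b (1 - \<theta>)))"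
    by (intro mult_left_mono *) simp
  also have "\<dots> = K * (rpow \<mu> \<theta> * (rpow a \<theta> * rpow b (1 - \<theta>)))"
    by (simp add: mult_ac)
  also have "\<dots> \<le> K * (R * g)"
    using rpow_weighted_mean[OF \<theta> \<open>\<mu> > 0\<close> ab(2,3)] \<open>K \<ge> 0\<close>
    unfolding R_def ab(1)[symmetric] by (intro mult_left_mono) auto
  finally have "g * (rpow \<mu> \<theta> * g) \<le> g * (K * R)"
    by (simp add: power2_eq_square mult_ac)
  then have "rpow \<mu> \<theta> * g \<le> K * R"
    using g(1) by simp
  then have "rpow \<mu> \<theta> * g / R \<le> K"
    using R by (simp add: field_simps)
  then show ?thesis
    by (simp add: Kfac_def V_eq R_def g(2) mult_ac)
qed

text \<open>Extracts \<open>\<mu> powr \<theta>\<close> from the energy so that \<open>V\<close>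
  appears; the remaining factor has the shape expected by \<open>optimise_scale\<close>.\<close>

lemma V_quadratic:
  assumes "\<mu> > 0"
  shows "Ig n \<mu> * (\<mu> * a + b) = V n \<theta> \<mu> * (\<mu> powr (1 - \<theta>) * a + \<mu> powr (- \<theta>) * b)"
proof -
  have "\<mu> powr \<theta> * \<mu> powr (1 - \<theta>) = \<mu>" "\<mu> powr \<theta> * \<mu> powr (- \<theta>) = 1"
    using assms by (simp_all flip: powr_add)
  then have "\<mu> powr \<theta> * (\<mu> powr (1 - \<theta>) * a + \<mu> powr (- \<theta>) * b) = \<mu> * a + b"
    by (simp add: distrib_left flip: mult.assoc)
  then show ?thesis
    using assms by (simp add: V_eq rpow_eq_powr mult.commute mult.left_commute)
qed

text \<open>The parameter plays two roles, inside \<open>V\<close> and as the scale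
  \<open>s\<close>. Replacing \<open>V\<close> by its bound \<open>S\<close> first separates them,
  so the scale can be optimised with a constant in front.\<close>

lemma discrete_ineq_upper:
  assumes \<theta>: "0 < \<theta>" "\<theta> < 1" and S: "\<And>\<mu>. \<mu> > 0 \<Longrightarrow> V n \<theta> \<mu> \<le> S"
  shows "discrete_ineq n \<theta> (Kfac \<theta> * S)"
  unfolding discrete_ineq_iff
proof
  fix u assume u: "u \<in> l2"
  define a b where "a = ip u u" and "b = ip (diff_op n u) (diff_op n u)"
  have ab: "0 \<le> a" "0 \<le> b" by (simp_all add: a_def b_def ip_self_nonneg)
  have "(u 0)\<^sup>2 \<le> S / pi * (s powr (1 - \<theta>) * a + s powr (- \<theta>) * b)" if s: "s > 0" for s
  proof -
    have "(u 0)\<^sup>2 \<le> Ig n s * (s * a + b) / pi"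
      using discrete_quadratic_ineq[OF s u, of n] by (simp add: a_def b_def)
    also have "\<dots> = V n \<theta> s * (s powr (1 - \<theta>) * a + s powr (- \<theta>) * b) / pi"
      by (simp only: V_quadratic[OF s, of n a b \<theta>])
    also have "\<dots> \<le> S * (s powr (1 - \<theta>) * a + s powr (- \<theta>) * b) / pi"
      using S[OF s] ab by (intro divide_right_mono mult_right_mono) auto
    finally show ?thesis by simp
  qed
  from optimise_scale[OF \<theta> ab this]
  show "(u 0)\<^sup>2 \<le> Kfac \<theta> * S * rpow (ip u u) \<theta> * rpow (ip (diff_op n u) (diff_op n u)) (1 - \<theta>)"
    by (simp add: Kfac_def a_def b_def mult_ac)
qed

text \<open>The endpoint outside the range of \<open>optimise_scale\<close>: the factor with
  exponent \<open>0\<close> is \<open>1\<close>, and a single term is at most the whole sum.\<close>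

lemma discrete_ineq_1: "discrete_ineq n 1 1"
  by (auto simp: discrete_ineq_iff rpow_def ip_self_ge intro: order_trans[OF ip_self_ge])

lemma K1_eq:
  assumes \<theta>: "0 < \<theta>" "\<theta> \<le> 1" and S: "discrete_ineq n \<theta> (Kfac \<theta> * (SUP \<mu>\<in>{0<..}. V n \<theta> \<mu>))"
  shows "K1 n \<theta> = Kfac \<theta> * (SUP \<mu>\<in>{0<..}. V n \<theta> \<mu>)"
    and "discrete_ineq n \<theta> K \<Longrightarrow> K1 n \<theta> \<le> K"
proof -
  have *: "Kfac \<theta> * (SUP \<mu>\<in>{0<..}. V n \<theta> \<mu>) \<le> K" if "discrete_ineq n \<theta> K" for K
  proof -
    have "(SUP \<mu>\<in>{0<..}. V n \<theta> \<mu>) \<le> K / Kfac \<theta>"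
      using discrete_ineq_lower[OF that \<theta>] Kfac_pos[OF \<theta>]
      by (intro cSUP_least) (auto simp: field_simps)
    then show ?thesis
      using Kfac_pos[OF \<theta>] by (simp add: field_simps)
  qed
  then show K1: "K1 n \<theta> = Kfac \<theta> * (SUP \<mu>\<in>{0<..}. V n \<theta> \<mu>)"
    unfolding K1_def using S by (intro cInf_eq_minimum) auto
  show "discrete_ineq n \<theta> K \<Longrightarrow> K1 n \<theta> \<le> K"
    unfolding K1 by (rule *)
qed

subsection \<open>The function \<open>V\<close> on the half line\<close>

lemma Ig_bounds:
  assumes "\<mu> > 0"
  shows "pi / (\<mu> + 4 ^ n) \<le> Ig n \<mu>" "Ig n \<mu> \<le> pi / \<mu>"
proof -
  have int: "(\<lambda>x. 1 / (\<mu> + symb n x)) integrable_on {0..pi}"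
    using symb_pos[OF assms, of n]
    by (intro integrable_continuous_real continuous_intros) (metis less_irrefl)
  have le4: "symb n x \<le> 4 ^ n" for x
    unfolding symb_alt using cos_ge_minus_one[of x] cos_le_one[of x] by (intro power_mono) linarith+
  have "integral {0..pi} (\<lambda>x. 1 / (\<mu> + 4 ^ n)) \<le> Ig n \<mu>"
    unfolding Ig_def using symb_pos[OF assms, of n] le4 assms
    by (intro integral_le int) (auto intro!: frac_le)
  then show "pi / (\<mu> + 4 ^ n) \<le> Ig n \<mu>" by simp
  have "Ig n \<mu> \<le> integral {0..pi} (\<lambda>x. 1 / \<mu>)"
    unfolding Ig_def using symb_nonneg[of n] assms
    by (intro integral_le int) (auto intro!: frac_le)
  then show "Ig n \<mu> \<le> pi / \<mu>" by simp
qed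

lemma continuous_on_Ig: "continuous_on {0<..} (Ig n)"
  unfolding Ig_def cbox_interval[symmetric]
proof (rule integral_continuous_on_param)
  have nz: "a + symb n x \<noteq> 0" if "a > 0" for a x
    using symb_pos[OF that, of n x] by simp
  have "continuous_on ({0<..} \<times> cbox 0 pi) (\<lambda>z. 1 / (fst z + symb n (snd z)))"
    by (intro continuous_intros continuous_on_compose2[OF continuous_symb[of UNIV n]])
      (auto simp: nz)
  then show "continuous_on ({0<..} \<times> cbox 0 pi) (\<lambda>(\<mu>, x). 1 / (\<mu> + symb n x))"
    by (simp add: case_prod_unfold)
qed

lemma V_powr: "\<mu> > 0 \<Longrightarrow> V n \<theta> \<mu> = \<mu> powr \<theta> * Ig n \<mu>"
  by (simp add: V_eq rpow_eq_powr)

lemma V_pos: "\<mu> > 0 \<Longrightarrow> V n \<theta> \<mu> > 0"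
  by (simp add: V_powr Ig_pos)

lemma continuous_on_V: "continuous_on {0<..} (V n \<theta>)"
proof -
  have "continuous_on {0<..} (\<lambda>\<mu>. \<mu> powr \<theta> * Ig n \<mu>)"
    by (intro continuous_intros continuous_on_Ig) auto
  then show ?thesis
    by (rule continuous_on_eq) (simp add: V_powr)
qed

lemma V_at_top:
  assumes "\<theta> < 1"
  shows "(V n \<theta> \<longlongrightarrow> 0) at_top"
proof (rule tendsto_sandwich)
  show "\<forall>\<^sub>F \<mu> in at_top. 0 \<le> V n \<theta> \<mu>"
    using eventually_gt_at_top[of 0] by eventually_elim (simp add: V_pos less_imp_le)
  show "\<forall>\<^sub>F \<mu> in at_top. V n \<theta> \<mu> \<le> pi * \<mu> powr (\<theta> - 1)"
    using eventually_gt_at_top[of 0]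
  proof eventually_elim
    case (elim \<mu>)
    then have "\<mu> powr \<theta> * Ig n \<mu> \<le> \<mu> powr \<theta> * (pi / \<mu>)"
      by (intro mult_left_mono Ig_bounds) auto
    then show ?case
      using elim by (simp add: V_powr powr_diff mult.commute)
  qed
  have "((\<lambda>\<mu>::real. pi * \<mu> powr (\<theta> - 1)) \<longlongrightarrow> pi * 0) at_top"
    using assms by (intro tendsto_intros tendsto_neg_powr filterlim_ident) auto
  then show "((\<lambda>\<mu>. pi * \<mu> powr (\<theta> - 1)) \<longlongrightarrow> 0) at_top" by simp
qed simp

lemma V_1_le: "\<mu> > 0 \<Longrightarrow> V n 1 \<mu> \<le> pi"
  using Ig_bounds(2)[of \<mu> n] by (simp add: V_powr field_simps)

lemma V_1_at_top: "(V n 1 \<longlongrightarrow> pi) at_top"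
proof (rule tendsto_sandwich)
  show "\<forall>\<^sub>F \<mu> in at_top. \<mu> * (pi / (\<mu> + 4 ^ n)) \<le> V n 1 \<mu>"
    using eventually_gt_at_top[of 0]
    by eventually_elim (simp add: V_powr Ig_bounds(1) del: times_divide_eq_right)
  show "\<forall>\<^sub>F \<mu> in at_top. V n 1 \<mu> \<le> pi"
    using eventually_gt_at_top[of 0] by eventually_elim (rule V_1_le)
  have "filterlim (\<lambda>\<mu>::real. \<mu> + 4 ^ n) at_top at_top"
    by (rule filterlim_at_top_mono[OF filterlim_ident]) auto
  then have "((\<lambda>\<mu>::real. pi - pi * 4 ^ n / (\<mu> + 4 ^ n)) \<longlongrightarrow> pi - 0) at_top"
    by (intro tendsto_intros tendsto_divide_0[OF tendsto_const] filterlim_at_top_imp_at_infinity)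
  then show "((\<lambda>\<mu>. \<mu> * (pi / (\<mu> + 4 ^ n))) \<longlongrightarrow> pi) at_top"
  proof (rule Lim_transform_eventually[THEN tendsto_eq_rhs])
    show "\<forall>\<^sub>F \<mu> in at_top. pi - pi * 4 ^ n / (\<mu> + 4 ^ n) = \<mu> * (pi / (\<mu> + 4 ^ n))"
      using eventually_gt_at_top[of 0]
    proof eventually_elim
      case (elim \<mu>)
      then have "\<mu> + 4 ^ n > 0" by (simp add: add_pos_pos)
      then show ?case by (simp add: field_simps)
    qed
  qed simp
qed simp

text \<open>For the two situations in which the supremum is a limit at an end:
  \<open>\<theta> = 1\<close> at infinity, and \<open>n = 1\<close> with
  \<open>\<theta> = 1 / 2\<close> at \<open>0\<close>.\<close>

lemma SUP_eq_limit:
  fixes F :: "real \<Rightarrow> real"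
  assumes "\<And>\<mu>. \<mu> > 0 \<Longrightarrow> F \<mu> \<le> l" "(F \<longlongrightarrow> l) G" "G \<noteq> bot" "\<forall>\<^sub>F \<mu> in G. \<mu> > 0"
  shows "(SUP \<mu>\<in>{0<..}. F \<mu>) = l" "bdd_above (F ` {0<..})"
proof -
  show bdd: "bdd_above (F ` {0<..})"
    using assms(1) by (intro bdd_aboveI[of _ l]) auto
  have "l \<le> (SUP \<mu>\<in>{0<..}. F \<mu>)"
    by (rule tendsto_upperbound[OF assms(2) _ assms(3)])
      (use assms(4) in eventually_elim, intro cSUP_upper bdd, simp)
  moreover have "(SUP \<mu>\<in>{0<..}. F \<mu>) \<le> l"
    using assms(1) by (intro cSUP_least) auto
  ultimately show "(SUP \<mu>\<in>{0<..}. F \<mu>) = l" by simp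
qed

text \<open>A value above both end limits confines the competition to a compact interval, where
  continuity gives a maximum.\<close>

lemma attains_max_half_line:
  fixes F :: "real \<Rightarrow> real"
  assumes cont: "continuous_on {0<..} F" and l: "(F \<longlongrightarrow> l0) (at_right 0)" "(F \<longlongrightarrow> l1) at_top"
    and m: "m > 0" "l0 < F m" "l1 < F m"
  obtains x where "x > 0" "\<And>y. y > 0 \<Longrightarrow> F y \<le> F x"
proof -
  obtain a where a: "a > 0" "\<And>y. 0 < y \<Longrightarrow> y < a \<Longrightarrow> F y < F m"
    using order_tendstoD(2)[OF l(1) m(2)] unfolding eventually_at_right_field by auto
  obtain b where b: "\<And>y. b \<le> y \<Longrightarrow> F y < F m"
    using order_tendstoD(2)[OF l(2) m(3)] unfolding eventually_at_top_linorder by auto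
  define c where "c = min a m"
  define d where "d = max b m"
  have "\<exists>x\<in>{c..d}. \<forall>y\<in>{c..d}. F y \<le> F x"
    using a m by (intro continuous_attains_sup continuous_on_subset[OF cont]) (auto simp: c_def d_def)
  then obtain x where x: "x \<in> {c..d}" "\<And>y. y \<in> {c..d} \<Longrightarrow> F y \<le> F x" by auto
  have mx: "F m \<le> F x" by (rule x(2)) (auto simp: c_def d_def)
  show ?thesis
  proof
    show "x > 0" using x(1) a(1) m(1) by (auto simp: c_def)
    show "F y \<le> F x" if "y > 0" for y
    proof (cases "y \<in> {c..d}")
      case False
      then have "y < a \<or> b \<le> y" by (auto simp: c_def d_def)
      then have "F y < F m" using a(2) b that by auto
      then show ?thesis using mx by simp
    qed (rule x(2))
  qed
qed

lemma bdd_above_half_line: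
  fixes F :: "real \<Rightarrow> real"
  assumes cont: "continuous_on {0<..} F" and l: "(F \<longlongrightarrow> l0) (at_right 0)" "(F \<longlongrightarrow> l1) at_top"
  shows "bdd_above (F ` {0<..})"
proof -
  obtain a where a: "a > 0" "\<And>y. 0 < y \<Longrightarrow> y < a \<Longrightarrow> F y < l0 + 1"
    using order_tendstoD(2)[OF l(1), of "l0 + 1"] unfolding eventually_at_right_field by auto
  obtain b where b: "\<And>y. b \<le> y \<Longrightarrow> F y < l1 + 1"
    using order_tendstoD(2)[OF l(2), of "l1 + 1"] unfolding eventually_at_top_linorder by auto
  have "bounded (F ` {a..b})"
    using a by (intro compact_imp_bounded compact_continuous_image continuous_on_subset[OF cont]) auto
  then obtain B where B: "\<And>y. y \<in> {a..b} \<Longrightarrow> \<bar>F y\<bar> \<le> B"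
    unfolding bounded_iff real_norm_def by blast
  have "F y \<le> max B (max (l0 + 1) (l1 + 1))" if "y > 0" for y
  proof -
    consider "y < a" | "y \<in> {a..b}" | "b \<le> y" by fastforce
    then show ?thesis using a(2)[of y] b[of y] B[of y] that by cases auto
  qed
  then show ?thesis by (intro bdd_aboveI) auto
qed

subsection \<open>The case of the first difference\<close>

lemma has_integral_poisson:
  fixes q :: real
  assumes "0 < q" "q < 1"
  shows "((\<lambda>x. (1 - q\<^sup>2) / (1 - 2 * q * cos x + q\<^sup>2)) has_integral pi) {0..pi}"
proof -
  \<comment> \<open>The \<open>arctan\<close> term is minus the argument of
    \<open>1 - q * exp (i x)\<close>. Its real part \<open>1 - q * cos x\<close> stays positive for
    \<open>q < 1\<close>, so this primitive has no branch jump and the term vanishes at both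
    \<open>0\<close> and \<open>pi\<close>.\<close>
  define F where "F x = x + 2 * arctan (q * sin x / (1 - q * cos x))" for x
  have deriv: "(F has_real_derivative (1 - q\<^sup>2) / (1 - 2 * q * cos x + q\<^sup>2)) (at x within A)" for x A
  proof -
    have "q * cos x \<le> q * 1" using assms by (intro mult_left_mono) auto
    then have nz: "1 - q * cos x > 0" using assms by linarith
    have sq: "(1 - q * cos x)\<^sup>2 + (q * sin x)\<^sup>2 = 1 - 2 * q * cos x + q\<^sup>2"
    proof -
      have "(1 - q * cos x)\<^sup>2 + (q * sin x)\<^sup>2 = 1 - 2 * q * cos x + q\<^sup>2 * ((sin x)\<^sup>2 + (cos x)\<^sup>2)"
        unfolding power2_diff power_mult_distrib distrib_left by simp
      then show ?thesis by simp
    qed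
    have den: "1 - 2 * q * cos x + q\<^sup>2 > 0"
      unfolding sq[symmetric] using nz by (intro add_pos_nonneg) auto
    have "(F has_real_derivative 1 + 2 * (inverse (1 + (q * sin x / (1 - q * cos x))\<^sup>2) *
        ((q * cos x * (1 - q * cos x) - q * sin x * (q * sin x)) / (1 - q * cos x)\<^sup>2))) (at x within A)"
      unfolding F_def using nz
      by (auto intro!: derivative_eq_intros simp: power2_eq_square)
    also have "q * cos x * (1 - q * cos x) - q * sin x * (q * sin x)
        = q * cos x - q\<^sup>2 * ((sin x)\<^sup>2 + (cos x)\<^sup>2)"
      by (simp only: power2_eq_square algebra_simps)
    also have "inverse (1 + (q * sin x / (1 - q * cos x))\<^sup>2)
        = (1 - q * cos x)\<^sup>2 / (1 - 2 * q * cos x + q\<^sup>2)"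
      using nz den unfolding sq[symmetric] by (simp add: field_simps)
    also have "1 + 2 * ((1 - q * cos x)\<^sup>2 / (1 - 2 * q * cos x + q\<^sup>2) *
        ((q * cos x - q\<^sup>2 * ((sin x)\<^sup>2 + (cos x)\<^sup>2)) / (1 - q * cos x)\<^sup>2))
        = (1 - q\<^sup>2) / (1 - 2 * q * cos x + q\<^sup>2)"
      using nz den by (simp add: divide_simps)
    finally show ?thesis .
  qed
  have "((\<lambda>x. (1 - q\<^sup>2) / (1 - 2 * q * cos x + q\<^sup>2)) has_integral (F pi - F 0)) {0..pi}"
    by (intro fundamental_theorem_of_calculus)
      (auto intro!: deriv simp flip: has_real_derivative_iff_has_vector_derivative)
  then show ?thesis by (simp add: F_def)
qed

text \<open>For \<open>n = 1\<close> the integrand is a multiple of the Poisson kernel. The closed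
  form decreases strictly in \<open>\<mu>\<close>, which makes this the exceptional critical
  case.\<close>

lemma V_first_difference:
  assumes "\<mu> > 0"
  shows "V 1 (1 / 2) \<mu> = pi / sqrt (\<mu> + 4)"
proof -
  define r where "r = sqrt (\<mu> * (\<mu> + 4))"
  \<comment> \<open>The root below \<open>1\<close> of \<open>q + 1 / q = \<mu> + 2\<close>, chosen
    so that \<open>\<mu> + 2 - 2 cos x = (1 - 2 q cos x + q^2) / q\<close>; correspondingly
    \<open>1 / q - q = r\<close>.\<close>
  define q where "q = (\<mu> + 2 - r) / 2"
  have r2: "r\<^sup>2 = \<mu>\<^sup>2 + 4 * \<mu>" using assms by (simp add: r_def power2_eq_square algebra_simps)
  have r: "r > 0" using assms by (simp add: r_def)
  have "r\<^sup>2 < (\<mu> + 2)\<^sup>2" unfolding r2 by (simp add: power2_eq_square algebra_simps)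
  then have "r < \<mu> + 2" using assms by (intro power2_less_imp_less[of r]) auto
  moreover have "\<mu>\<^sup>2 < r\<^sup>2" unfolding r2 using assms by simp
  then have "\<mu> < r" using r by (intro power2_less_imp_less[of \<mu>]) auto
  ultimately have q: "0 < q" "q < 1" by (auto simp: q_def)
  have qq: "1 + q\<^sup>2 = (\<mu> + 2) * q" and rq: "1 - q\<^sup>2 = r * q"
    using r2 by (simp_all add: q_def power2_eq_square field_simps)
  have "(\<lambda>x. (1 - q\<^sup>2) / (1 - 2 * q * cos x + q\<^sup>2)) = (\<lambda>x. r * (1 / (\<mu> + symb 1 x)))"
  proof
    fix x
    have "1 - 2 * q * cos x + q\<^sup>2 = q * (\<mu> + symb 1 x)"
      using qq by (simp add: symb_alt algebra_simps)
    then show "(1 - q\<^sup>2) / (1 - 2 * q * cos x + q\<^sup>2) = r * (1 / (\<mu> + symb 1 x))"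
      using q by (simp add: rq)
  qed
  then have "((\<lambda>x. r * (1 / (\<mu> + symb 1 x))) has_integral pi) {0..pi}"
    using has_integral_poisson[OF q] by simp
  then have "r * Ig 1 \<mu> = pi"
    unfolding Ig_def integral_mult_right[symmetric] by (rule integral_unique)
  moreover have "r = sqrt \<mu> * sqrt (\<mu> + 4)" by (simp add: r_def real_sqrt_mult)
  ultimately have "sqrt \<mu> * Ig 1 \<mu> * sqrt (\<mu> + 4) = pi" by (simp add: mult_ac)
  then show ?thesis
    using assms by (simp add: V_powr powr_half_sqrt field_simps)
qed

lemma V_first_difference_limit:
  shows "(V 1 (1 / 2) \<longlongrightarrow> pi / 2) (at_right 0)"
    and "\<mu> > 0 \<Longrightarrow> V 1 (1 / 2) \<mu> \<le> pi / 2"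
proof -
  have "((\<lambda>\<mu>. pi / sqrt (\<mu> + 4)) \<longlongrightarrow> pi / sqrt (0 + 4)) (at_right 0)"
    by (intro tendsto_intros) auto
  then have "((\<lambda>\<mu>. pi / sqrt (\<mu> + 4)) \<longlongrightarrow> pi / 2) (at_right 0)" by simp
  then show "(V 1 (1 / 2) \<longlongrightarrow> pi / 2) (at_right 0)"
    by (rule Lim_transform_eventually)
      (auto intro!: eventually_mono[OF eventually_at_right_less] V_first_difference[symmetric,
          unfolded One_nat_def])
  assume "\<mu> > 0"
  moreover from this have "sqrt 4 \<le> sqrt (\<mu> + 4)" by (intro real_sqrt_le_mono) simp
  ultimately show "V 1 (1 / 2) \<mu> \<le> pi / 2"
    unfolding V_first_difference[OF \<open>\<mu> > 0\<close>] by (intro divide_left_mono) auto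
qed

subsection \<open>The critical exponent\<close>

definition crit :: "nat \<Rightarrow> real" where
  "crit n = 1 - 1 / (2 * real n)"

text \<open>The integrand of \<open>V n (crit n) (e ^ (2 * n))\<close> after the substitution
  \<open>x = e * s\<close>, extended by zero to the line; \<open>2 * sin (e * s / 2) / e\<close> is
  the deformed version of \<open>s\<close>.\<close>

definition scaled :: "nat \<Rightarrow> real \<Rightarrow> real \<Rightarrow> real" where
  "scaled n e s = indicator {0..pi} (e * s) / (1 + (2 * sin (e * s / 2) / e) ^ (2 * n))"

definition limfun :: "nat \<Rightarrow> real \<Rightarrow> real" where
  "limfun n s = indicator {0..} s / (1 + s ^ (2 * n))"

lemma measurable_scaled [measurable]: "scaled n e \<in> borel_measurable lborel"
  unfolding scaled_def by measurable

lemma measurable_limfun [measurable]: "limfun n \<in> borel_measurable lborel"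
  unfolding limfun_def by measurable

lemma V_crit_scaled:
  assumes "n \<ge> 1" "e > 0"
  shows "V n (crit n) (e ^ (2 * n)) = (LINT s|lborel. scaled n e s)"
proof -
  define m where "m = e ^ (2 * n)"
  have m: "m > 0" using assms by (simp add: m_def)
  \<comment> \<open>Here the exponent is critical: the division by \<open>e\<close> cancels the
    Jacobian of \<open>x = e * s\<close>.\<close>
  have mp: "m powr crit n = m / e"
  proof -
    have "m powr (1 / (2 * real n)) = (e powr (2 * real n)) powr (1 / (2 * real n))"
      using assms by (simp add: m_def powr_realpow[symmetric])
    also have "\<dots> = e" using assms by (simp add: powr_powr)
    finally show ?thesis using m by (simp add: crit_def powr_diff)
  qed
  have cont: "continuous_on {0..pi} (\<lambda>x. 1 / (m + symb n x))"
    using symb_pos[OF m, of n] by (intro continuous_intros) (metis less_irrefl)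
  have "Ig n m = (LINT x:{0..pi}|lborel. 1 / (m + symb n x))"
    unfolding Ig_def
    by (rule set_borel_integral_eq_integral(2)[symmetric] borel_integrable_atLeastAtMost' cont)+
  also have "\<dots> = e * (LINT s|lborel. indicator {0..pi} (e * s) / (m + symb n (e * s)))"
    unfolding set_lebesgue_integral_def
    using assms by (subst lborel_integral_real_affine[where c=e and t=0]) auto
  finally have "V n (crit n) m = m * (LINT s|lborel. indicator {0..pi} (e * s) / (m + symb n (e * s)))"
    using assms m by (simp add: V_powr mp)
  also have "\<dots> = (LINT s|lborel. m * (indicator {0..pi} (e * s) / (m + symb n (e * s))))"
    by (simp only: Bochner_Integration.integral_mult_right_zero)
  also have "(\<lambda>s. m * (indicator {0..pi} (e * s) / (m + symb n (e * s)))) = scaled n e"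
  proof
    fix s
    have "symb n (e * s) = m * (2 * sin (e * s / 2) / e) ^ (2 * n)"
      using assms by (simp add: symb_def m_def power_divide power_mult_distrib)
    then have "m + symb n (e * s) = m * (1 + (2 * sin (e * s / 2) / e) ^ (2 * n))"
      by (simp add: distrib_left)
    then show "m * (indicator {0..pi} (e * s) / (m + symb n (e * s))) = scaled n e s"
      using m by (simp add: scaled_def)
  qed
  finally show ?thesis by (simp add: m_def)
qed

section \<open>Bounds on the sine, an integrable majorant and the limit at zero\<close>

lemma sin_ge_half:
  assumes "0 \<le> y" "y \<le> pi / 2"
  shows "y / 2 \<le> sin y"
proof -
  have "(\<Sum>m<3. sin_coeff m * y ^ m) = y"
    by (simp add: lessThan_nat_numeral lessThan_Suc sin_coeff_def)
  moreover have "inverse (fact 3) * \<bar>y\<bar> ^ 3 = y ^ 3 / 6"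
    using assms by (simp add: fact_numeral)
  ultimately have "\<bar>sin y - y\<bar> \<le> y ^ 3 / 6"
    using Maclaurin_sin_bound[of y 3] by (simp only:)
  then have "y - y ^ 3 / 6 \<le> sin y" by linarith
  \<comment> \<open>The cubic term is at most \<open>y / 2\<close> once \<open>y^2 <= 3\<close>, and
    \<open>pi / 2 <= 1.6\<close> leaves ample room.\<close>
  moreover have "y\<^sup>2 \<le> (pi / 2)\<^sup>2" using assms by (intro power_mono) auto
  moreover have "(pi / 2)\<^sup>2 \<le> (3.2 / 2)\<^sup>2" using pi_approx by (intro power_mono) auto
  ultimately have "y\<^sup>2 \<le> 3" by (simp add: power2_eq_square)
  then have "y * y\<^sup>2 \<le> y * 3" using assms by (intro mult_left_mono) auto
  with \<open>y - y ^ 3 / 6 \<le> sin y\<close> show ?thesis by (simp add: power3_eq_cube power2_eq_square)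
qed

text \<open>On \<open>[0, 1]\<close> the quintic remainder takes at most \<open>1 / 120\<close> of
  the cubic coefficient \<open>1 / 6\<close>, which leaves more than \<open>1 / 12\<close>. This
  measures the gain of order \<open>e^2\<close> in \<open>V_crit_exceeds_limit\<close>.\<close>

lemma sin_le_cubic:
  fixes y :: real
  assumes "0 \<le> y" "y \<le> 1"
  shows "sin y \<le> y - y ^ 3 / 12"
proof -
  have "{..<5} = {0, 1, 2, 3, 4::nat}" by auto
  then have "(\<Sum>m<5. sin_coeff m * y ^ m) = y - y ^ 3 / 6"
    by (simp add: sin_coeff_def fact_numeral)
  moreover have "inverse (fact 5) * \<bar>y\<bar> ^ 5 = y ^ 5 / 120"
    using assms by (simp add: fact_numeral)
  ultimately have "\<bar>sin y - (y - y ^ 3 / 6)\<bar> \<le> y ^ 5 / 120"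
    using Maclaurin_sin_bound[of y 5] by (simp only:)
  then have "sin y \<le> y - y ^ 3 / 6 + y ^ 5 / 120" by linarith
  moreover have "y ^ 5 \<le> y ^ 3" using assms by (intro power_decreasing) auto
  moreover have "0 \<le> y ^ 3" using assms by simp
  ultimately show ?thesis by linarith
qed

text \<open>One bound for all \<open>scaled n e\<close>. The factor \<open>8\<close> is
  \<open>2\<close> from \<open>inverse_power_le\<close> times \<open>4\<close> from replacing
  \<open>s\<close> by \<open>s / 2\<close> through \<open>sin_ge_half\<close>.\<close>

definition majorant :: "real \<Rightarrow> real" where
  "majorant s = 8 * (indicator {0..} s * (1 / (1 + s\<^sup>2)))"

text \<open>The term \<open>y^2\<close> is at most \<open>1\<close> below \<open>1\<close> and at
  most \<open>y^(2n)\<close> above it; the factor \<open>2\<close> covers both ranges.\<close>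

lemma inverse_power_le:
  fixes y :: real
  assumes "0 \<le> y" "n \<ge> 1"
  shows "1 / (1 + y ^ (2 * n)) \<le> 2 / (1 + y\<^sup>2)"
proof -
  have "y\<^sup>2 \<le> 1 \<or> y\<^sup>2 \<le> y ^ (2 * n)"
  proof (cases "y \<le> 1")
    case True
    then show ?thesis using assms by (simp add: power_le_one)
  next
    case False
    then have "y\<^sup>2 \<le> y ^ (2 * n)" using assms by (intro power_increasing) auto
    then show ?thesis ..
  qed
  moreover have "0 \<le> y ^ (2 * n)" "0 \<le> y\<^sup>2" using assms by simp_all
  ultimately have "1 + y\<^sup>2 \<le> 2 * (1 + y ^ (2 * n))" by argo
  moreover have "0 < 1 + y\<^sup>2" "0 < 1 + y ^ (2 * n)"
    using assms by (auto intro!: add_pos_nonneg)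
  ultimately show ?thesis by (simp add: field_simps)
qed

lemma integrable_majorant: "integrable lborel majorant"
proof -
  have "set_integrable lborel {0<..} (\<lambda>x::real. 1 / (1 + x\<^sup>2))"
    using integrable_I0i_1_div_plus_square
    by (simp add: interval_lebesgue_integrable_def zero_ereal_def)
  then have "integrable lborel (\<lambda>x::real. indicator {0<..} x * (1 / (1 + x\<^sup>2)))"
    by (simp add: set_integrable_def)
  moreover have "AE x in lborel. indicator {0<..} x * (1 / (1 + x\<^sup>2))
      = (indicator {0..} x * (1 / (1 + x\<^sup>2)) :: real)"
    by (rule eventually_mono[OF AE_lborel_singleton[of "0::real"]]) (auto simp: indicator_def)
  ultimately have "integrable lborel (\<lambda>x::real. indicator {0..} x * (1 / (1 + x\<^sup>2)))"
    by (subst (asm) integrable_cong_AE) auto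
  then show ?thesis unfolding majorant_def by (intro integrable_mult_right)
qed

lemma scaled_le_majorant:
  assumes "n \<ge> 1" "e > 0"
  shows "norm (scaled n e s) \<le> majorant s"
proof (cases "e * s \<in> {0..pi}")
  case True
  then have s: "0 \<le> s" using assms by (simp add: zero_le_mult_iff)
  let ?d = "2 * sin (e * s / 2) / e"
  have "e * s / 2 / 2 \<le> sin (e * s / 2)" using True by (intro sin_ge_half) auto
  then have d: "s / 2 \<le> ?d" using assms by (simp add: field_simps)
  have "norm (scaled n e s) = 1 / (1 + ?d ^ (2 * n))"
    using True by (simp add: scaled_def)
  also have "\<dots> \<le> 1 / (1 + (s / 2) ^ (2 * n))"
    using d s by (intro divide_left_mono add_left_mono power_mono mult_pos_pos add_pos_nonneg) auto
  also have "\<dots> \<le> 2 / (1 + (s / 2)\<^sup>2)"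
    using s assms by (intro inverse_power_le) auto
  also have "\<dots> \<le> 8 / (1 + s\<^sup>2)"
  proof -
    have "0 < 4 + s\<^sup>2" "0 < 1 + s\<^sup>2" by (auto intro!: add_pos_nonneg)
    then show ?thesis by (simp add: power_divide divide_simps)
  qed
  finally show ?thesis using s by (simp add: majorant_def)
qed (auto simp: scaled_def majorant_def)

lemma integrable_scaled: "n \<ge> 1 \<Longrightarrow> e > 0 \<Longrightarrow> integrable lborel (scaled n e)"
  by (rule Bochner_Integration.integrable_bound[OF integrable_majorant])
    (auto intro!: AE_I2 order_trans[OF scaled_le_majorant] simp del: real_norm_def simp:
        real_norm_def[of "majorant _"])

lemma integrable_limfun:
  assumes "n \<ge> 1"
  shows "integrable lborel (limfun n)"
proof (rule Bochner_Integration.integrable_bound[OF integrable_majorant])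
  have "norm (limfun n s) \<le> norm (majorant s)" for s
  proof (cases "0 \<le> s")
    case True
    have "1 / (1 + s ^ (2 * n)) \<le> 2 / (1 + s\<^sup>2)" by (rule inverse_power_le) fact+
    also have "\<dots> \<le> 8 / (1 + s\<^sup>2)" by (intro divide_right_mono) auto
    finally show ?thesis using True by (simp add: limfun_def majorant_def)
  qed (simp add: limfun_def)
  then show "AE s in lborel. norm (limfun n s) \<le> norm (majorant s)" by simp
qed simp

text \<open>The limit is taken in \<open>t = 1 / e\<close> so that dominated convergence along
  \<open>at_top\<close> applies.\<close>

lemma scaled_tendsto:
  assumes "n \<ge> 1"
  shows "((\<lambda>t. scaled n (1 / t) s) \<longlongrightarrow> limfun n s) at_top"
proof (cases "s > 0")
  case True
  have lim: "((\<lambda>t::real. s / t / 2) \<longlongrightarrow> 0) at_top"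
    by (intro tendsto_divide_zero tendsto_divide_0[OF tendsto_const]
        filterlim_at_top_imp_at_infinity filterlim_ident)
  have "((\<lambda>y::real. sin y / y) \<longlongrightarrow> 1) (at 0)"
    using DERIV_sin[of "0::real"] by (simp add: has_field_derivative_iff)
  then have "((\<lambda>t. sin (s / t / 2) / (s / t / 2)) \<longlongrightarrow> 1) at_top"
  proof (rule filterlim_compose)
    show "filterlim (\<lambda>t. s / t / 2) (at 0) at_top"
      unfolding filterlim_at using True lim
      by (intro conjI lim eventually_mono[OF eventually_gt_at_top[of "0::real"]]) auto
  qed
  then have "((\<lambda>t. 1 / (1 + (s * (sin (s / t / 2) / (s / t / 2))) ^ (2 * n)))
      \<longlongrightarrow> 1 / (1 + (s * 1) ^ (2 * n))) at_top"
    using True by (intro tendsto_intros) (auto simp: add_nonneg_eq_0_iff)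
  moreover have "\<forall>\<^sub>F t in at_top. 1 / (1 + (s * (sin (s / t / 2) / (s / t / 2))) ^ (2 * n))
      = scaled n (1 / t) s"
    using eventually_gt_at_top[of "s / pi"] eventually_gt_at_top[of 0]
  proof eventually_elim
    case (elim t)
    then have "s / t \<in> {0..pi}" using True by (simp add: field_simps)
    then show ?case using elim True by (simp add: scaled_def field_simps)
  qed
  ultimately show ?thesis
    using True by (auto simp: limfun_def dest: Lim_transform_eventually)
next
  \<comment> \<open>For \<open>s < 0\<close> both sides vanish, and at \<open>s = 0\<close> both
    equal \<open>1\<close>.\<close>
  case False
  have "\<forall>\<^sub>F t in at_top. scaled n (1 / t) s = limfun n s"
    using eventually_gt_at_top[of 0]
    by eventually_elim (use False assms in \<open>auto simp: scaled_def limfun_def indicator_def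
        field_simps zero_le_divide_iff\<close>)
  then show ?thesis by (rule tendsto_eventually)
qed

lemma V_crit_limit:
  assumes "n \<ge> 1"
  shows "(V n (crit n) \<longlongrightarrow> integral\<^sup>L lborel (limfun n)) (at_right 0)"
proof -
  have "((\<lambda>t. integral\<^sup>L lborel (scaled n (1 / t))) \<longlongrightarrow> integral\<^sup>L lborel (limfun n)) at_top"
  proof (rule integral_dominated_convergence_at_top[OF _ _ integrable_majorant])
    show "\<forall>\<^sub>F t in at_top. AE s in lborel. norm (scaled n (1 / t) s) \<le> majorant s"
      using eventually_gt_at_top[of 0] by eventually_elim (intro AE_I2 scaled_le_majorant assms, simp)
  qed (auto intro: scaled_tendsto[OF assms])
  \<comment> \<open>The quantity \<open>1 / e\<close> expressed through
    \<open>\<mu> = e^(2n)\<close>.\<close>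
  moreover have "filterlim (\<lambda>\<mu>::real. \<mu> powr (- (1 / (2 * real n)))) at_top (at_right 0)"
  proof -
    have "filterlim (\<lambda>\<mu>::real. \<mu> powr (1 / (2 * real n))) (at_right 0) (at_right 0)"
      unfolding filterlim_at
    proof
      show "((\<lambda>\<mu>::real. \<mu> powr (1 / (2 * real n))) \<longlongrightarrow> 0) (at_right 0)"
        using assms by (auto intro!: tendsto_eq_intros tendsto_powr' eventually_mono[OF
            eventually_at_right_less])
    qed (auto intro!: eventually_mono[OF eventually_at_right_less])
    from filterlim_compose[OF filterlim_inverse_at_top_right this] show ?thesis
      by (simp add: powr_minus)
  qed
  ultimately have "((\<lambda>\<mu>. integral\<^sup>L lborel (scaled n (1 / \<mu> powr (- (1 / (2 * real n))))))
      \<longlongrightarrow> integral\<^sup>L lborel (limfun n)) (at_right 0)"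
    by (rule filterlim_compose)
  then show ?thesis
  proof (rule Lim_transform_eventually)
    have "integral\<^sup>L lborel (scaled n (1 / \<mu> powr (- (1 / (2 * real n)))))
        = V n (crit n) \<mu>" if "\<mu> > 0" for \<mu>
    proof -
      have "(\<mu> powr (1 / (2 * real n))) ^ (2 * n) = \<mu>"
        using that assms by (subst powr_realpow[symmetric]) (auto simp: powr_powr)
      then show ?thesis
        using V_crit_scaled[OF assms, of "\<mu> powr (1 / (2 * real n))"] that
            by (simp add: powr_minus_divide)
    qed
    then show "\<forall>\<^sub>F \<mu> in at_right 0. integral\<^sup>L lborel (scaled n (1 / \<mu> powr (- (1 / (2 * real n)))))
        = V n (crit n) \<mu>"
      by (auto intro!: eventually_mono[OF eventually_at_right_less])
  qed
qed

text \<open>Compared with the critical exponent, a positive power of \<open>\<mu>\<close> is left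
  over, and it multiplies a function with a finite limit.\<close>

lemma V_zero_limit:
  assumes "n \<ge> 1" "crit n < \<theta>"
  shows "(V n \<theta> \<longlongrightarrow> 0) (at_right 0)"
proof -
  have "((\<lambda>\<mu>::real. \<mu> powr (\<theta> - crit n)) \<longlongrightarrow> 0) (at_right 0)"
    using assms by (auto intro!: tendsto_eq_intros tendsto_powr' eventually_mono[OF
        eventually_at_right_less])
  from tendsto_mult[OF this V_crit_limit[OF assms(1)]]
  have "((\<lambda>\<mu>. \<mu> powr (\<theta> - crit n) * V n (crit n) \<mu>) \<longlongrightarrow> 0) (at_right 0)" by simp
  then show ?thesis
    by (rule Lim_transform_eventually)
      (auto intro!: eventually_mono[OF eventually_at_right_less] simp: V_powr simp flip: mult.assoc
          powr_add)
qed

text \<open>For \<open>n \<ge> 2\<close> the gain of order \<open>e\<^sup>2\<close> on \<open>[1, 2]\<close>, where the sine is below its argument,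
  outweighs the missing tail beyond \<open>pi / e\<close>, which is at most of order \<open>e\<^sup>3\<close>.\<close>

lemma V_crit_exceeds_limit:
  assumes n: "n \<ge> 2"
  obtains \<mu> where "\<mu> > 0" "integral\<^sup>L lborel (limfun n) < V n (crit n) \<mu>"
proof -
  \<comment> \<open>On \<open>[1, 2]\<close> the cubic term of \<open>sin_le_cubic\<close> at
    \<open>e * s / 2\<close> gives a gap of at least \<open>e^2 / 48\<close> between
    \<open>s\<close> and its deformation, and each of the two denominators is at most
    \<open>1 + 2^(2n)\<close>.\<close>
  define c :: real where "c = 1 / (48 * (1 + 2 ^ (2 * n))\<^sup>2)"
  \<comment> \<open>The bound \<open>e <= c\<close> makes the tail, of order \<open>e^3\<close>,
    smaller than the gain \<open>c * e^2\<close>; the bound \<open>e <= 1\<close> keeps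
    \<open>e * s / 2\<close> in the range of \<open>sin_le_cubic\<close> and \<open>pi / e\<close>
    beyond \<open>3\<close>.\<close>
  define e where "e = min c 1"
  have pos: "1 + 2 ^ (2 * n) > (0::real)" by (intro add_pos_pos) auto
  have c: "c > 0" using pos by (simp add: c_def)
  have e: "0 < e" "e \<le> 1" "e \<le> c" using c by (auto simp: e_def)
  \<comment> \<open>A pointwise minorant of \<open>scaled n e - limfun n\<close> with explicit
    integral: the gain on \<open>[1, 2]\<close> minus a bound for the missing tail. The power
    \<open>4\<close> uses \<open>n >= 2\<close>; with \<open>s^(-2)\<close> the tail would be of
    order \<open>e\<close> and outweigh the gain.\<close>
  define lo where "lo s = c * e\<^sup>2 * indicator {1..2} s - indicator {pi / e..} s * (1
      / s ^ 4)" for s :: real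
  have hi: "((\<lambda>x::real. 1 / x ^ 4) has_integral 1 / (3 * (pi / e) ^ 3)) {pi / e..}"
    using has_integral_inverse_power_to_inf[of 4 "pi / e"] e by simp
  have set_int: "set_integrable lborel {pi / e..} (\<lambda>x::real. 1 / x ^ 4)"
  proof -
    have "set_integrable lebesgue {pi / e..} (\<lambda>x::real. 1 / x ^ 4)"
      using hi by (intro nonnegative_absolutely_integrable_1) (auto simp: has_integral_iff)
    then show ?thesis
      by (simp add: set_integrable_def integrable_completion)
  qed
  have tail: "integrable lborel (\<lambda>s. indicator {pi / e..} s * (1 / s ^ 4))"
    "(LINT s|lborel. indicator {pi / e..} s * (1 / s ^ 4)) = 1 / (3 * (pi / e) ^ 3)"
    using set_int set_borel_integral_eq_integral(2)[OF set_int] hi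
    by (auto simp: set_integrable_def set_lebesgue_integral_def has_integral_iff)
  have lo: "integrable lborel lo" "(LINT s|lborel. lo s) = c * e\<^sup>2 - 1 / (3 * (pi / e) ^ 3)"
    unfolding lo_def using tail by (simp_all add: Bochner_Integration.integral_diff)
  have "lo s \<le> scaled n e s - limfun n s" for s
  proof -
    consider "s < 0" | "0 \<le> s" "s \<le> pi / e" | "pi / e < s" by linarith
    then show ?thesis
    proof cases
      case 1
      then have "e * s < 0" using e by (simp add: mult_pos_neg)
      moreover have "0 < pi / e" using e by simp
      ultimately have "lo s = 0" "scaled n e s = 0" "limfun n s = 0"
        using 1 by (auto simp: lo_def scaled_def limfun_def indicator_def)
      then show ?thesis by simp
    next
      case 2
      define d where "d = 2 * sin (e * s / 2) / e"
      have es: "0 \<le> e * s" "e * s \<le> pi" using 2 e by (simp_all add: field_simps)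
      have d: "0 \<le> d" "d \<le> s"
        using es e sin_x_le_x[of "e * s / 2"] by (auto simp: d_def field_simps intro!: sin_ge_zero)
      have dN: "d ^ (2 * n) \<le> s ^ (2 * n)" using d by (intro power_mono)
      have den: "0 < 1 + d ^ (2 * n)" "0 < 1 + s ^ (2 * n)"
        using d by (auto intro!: add_pos_nonneg)
      have eq: "scaled n e s - limfun n s
          = (s ^ (2 * n) - d ^ (2 * n)) / ((1 + d ^ (2 * n)) * (1 + s ^ (2 * n)))"
        using es 2 den by (simp add: scaled_def limfun_def d_def[symmetric] diff_frac_eq)
      show ?thesis
      proof (cases "s \<in> {1..2}")
        case False
        then have "lo s \<le> 0" using 2 by (simp add: lo_def)
        also have "0 \<le> scaled n e s - limfun n s"
          unfolding eq using dN den by (intro divide_nonneg_pos) auto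
        finally show ?thesis .
      next
        case True
        have sm: "e * s / 2 \<le> 1" using True e mult_mono[of e 1 s 2] by auto
        have "2 * sin (e * s / 2) \<le> 2 * (e * s / 2 - (e * s / 2) ^ 3 / 12)"
          using es sm by (intro mult_left_mono sin_le_cubic) auto
        then have "d \<le> s - e\<^sup>2 * s ^ 3 / 48"
          using e by (simp add: d_def field_simps power2_eq_square power3_eq_cube)
        moreover have "e\<^sup>2 * 1 \<le> e\<^sup>2 * s ^ 3" using True by (intro mult_left_mono) auto
        ultimately have gap: "e\<^sup>2 / 48 \<le> s - d" by simp
        \<comment> \<open>One factor is split off each power:
          \<open>s^(2n) - d^(2n) >= (s - d) * s^(2n-1) >= s - d\<close>, because
          \<open>d <= s\<close> and \<open>s >= 1\<close>.\<close>
        have s1: "1 \<le> s ^ (2 * n - 1)" using True by simp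
        have Suc: "x * x ^ (2 * n - 1) = x ^ (2 * n)" for x :: real
          using n by (simp flip: power_Suc)
        have "e\<^sup>2 / 48 \<le> (s - d) * 1" using gap by simp
        also have "\<dots> \<le> (s - d) * s ^ (2 * n - 1)"
          using s1 d by (intro mult_left_mono) auto
        also have "\<dots> = s ^ (2 * n) - d * s ^ (2 * n - 1)"
          by (simp only: left_diff_distrib Suc)
        also have "\<dots> \<le> s ^ (2 * n) - d * d ^ (2 * n - 1)"
          using d by (intro diff_left_mono mult_left_mono power_mono) auto
        also note Suc
        finally have num: "e\<^sup>2 / 48 \<le> s ^ (2 * n) - d ^ (2 * n)" .
        have s2: "s ^ (2 * n) \<le> 2 ^ (2 * n)" using True by (intro power_mono) auto
        have "c * e\<^sup>2 = (e\<^sup>2 / 48) / ((1 + 2 ^ (2 * n)) * (1 + 2 ^ (2 * n)))"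
          by (simp add: c_def power2_eq_square)
        also have "\<dots> \<le> (s ^ (2 * n) - d ^ (2 * n)) / ((1 + d ^ (2 * n)) * (1 + s ^ (2 * n)))"
          using num dN s2 den by (intro frac_le mult_mono mult_pos_pos) auto
        also have "\<dots> = scaled n e s - limfun n s" by (rule eq[symmetric])
        finally have "c * e\<^sup>2 \<le> scaled n e s - limfun n s" .
        moreover have "lo s \<le> c * e\<^sup>2"
          using True by (simp add: lo_def)
        ultimately show ?thesis by simp
      qed
    next
      case 3
      have "3 < pi / e" using e pi_gt3 by (simp add: field_simps)
      then have s: "3 < s" using 3 by simp
      have "s ^ 4 \<le> s ^ (2 * n)" using s n by (intro power_increasing) auto
      then have le: "s ^ 4 \<le> 1 + s ^ (2 * n)" by linarith
      have "1 / (1 + s ^ (2 * n)) \<le> 1 / s ^ 4"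
        by (rule divide_left_mono[OF le]) (use s in \<open>auto intro!: mult_pos_pos add_pos_pos\<close>)
      moreover have "lo s = - (1 / s ^ 4)" using 3 s by (simp add: lo_def)
      moreover have "scaled n e s = 0" using 3 e by (simp add: scaled_def field_simps)
      moreover have "limfun n s = 1 / (1 + s ^ (2 * n))" using s by (simp add: limfun_def)
      ultimately show ?thesis by simp
    qed
  qed
  moreover have int: "integrable lborel (scaled n e)" "integrable lborel (limfun n)"
    using n e by (auto intro: integrable_scaled integrable_limfun)
  ultimately have "(LINT s|lborel. lo s) \<le> (LINT s|lborel. scaled n e s - limfun n s)"
    using lo by (intro integral_mono Bochner_Integration.integrable_diff) auto
  also have "\<dots> = V n (crit n) (e ^ (2 * n)) - integral\<^sup>L lborel (limfun n)"
    using int n e V_crit_scaled[of n e] by simp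
  finally have *: "c * e\<^sup>2 - 1 / (3 * (pi / e) ^ 3)
      \<le> V n (crit n) (e ^ (2 * n)) - integral\<^sup>L lborel (limfun n)"
    by (simp add: lo)
  \<comment> \<open>The tail integral is \<open>e^3 / (3 * pi^3)\<close>, hence below
    \<open>e * e^2\<close>, and \<open>e <= c\<close> finishes the comparison.\<close>
  have "1 < pi ^ 3" using pi_gt3 by (intro one_less_power) auto
  then have "1 < 3 * pi ^ 3" by linarith
  then have "1 / (3 * (pi / e) ^ 3) < e ^ 3"
    using e by (simp add: power_divide field_simps)
  also have "\<dots> = e * e\<^sup>2" by (simp add: power2_eq_square power3_eq_cube)
  also have "\<dots> \<le> c * e\<^sup>2" using e by (intro mult_right_mono) auto
  finally have "integral\<^sup>L lborel (limfun n) < V n (crit n) (e ^ (2 * n))" using * by linarith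
  then show ?thesis using that[of "e ^ (2 * n)"] e by simp
qed

subsection \<open>Smooth functions on the line\<close>

definition smooth :: "(real \<Rightarrow> real) \<Rightarrow> bool" where
  "smooth f \<longleftrightarrow> (\<forall>k x. (deriv ^^ k) f field_differentiable at x)"

lemma test_fun_iff: "test_fun \<phi> \<longleftrightarrow> smooth \<phi> \<and> bounded {x. \<phi> x \<noteq> 0}"
  by (simp add: test_fun_def smooth_def)

text \<open>Membership in a class stable under \<open>deriv\<close> replaces explicit formulas for
  higher derivatives; the closure properties below work by exhibiting such classes.\<close>

lemma smooth_coinduct:
  assumes "S f" and step: "\<And>g. S g \<Longrightarrow> (\<forall>x. g field_differentiable at x) \<and> S (deriv g)"
  shows "smooth f"
proof -
  have "S ((deriv ^^ k) f)" for k
    by (induction k) (use assms in auto)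
  then show ?thesis using step by (simp add: smooth_def)
qed

lemma smooth_differentiable: "smooth f \<Longrightarrow> f field_differentiable at x"
  unfolding smooth_def by (metis funpow_0)

lemma smooth_deriv: "smooth f \<Longrightarrow> smooth (deriv f)"
  unfolding smooth_def by (metis comp_apply funpow_Suc_right)

lemma smooth_DERIV: "smooth f \<Longrightarrow> (f has_real_derivative deriv f x) (at x)"
  by (simp add: DERIV_deriv_iff_field_differentiable smooth_differentiable)

lemma smooth_of_DERIV:
  assumes "\<And>x. (f has_real_derivative g x) (at x)" "smooth g"
  shows "smooth f" "deriv f = g"
proof -
  show d: "deriv f = g" using assms(1) by (auto intro: DERIV_imp_deriv)
  show "smooth f"
  proof (rule smooth_coinduct[where S="\<lambda>h. h = f \<or> smooth h"])
    fix h assume "h = f \<or> smooth h"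
    then show "(\<forall>x. h field_differentiable at x) \<and> (deriv h = f \<or> smooth (deriv h))"
    proof
      assume "h = f"
      then show ?thesis using assms d by (auto simp: field_differentiable_def)
    qed (simp add: smooth_differentiable smooth_deriv)
  qed simp
qed

lemma smooth_continuous: "smooth f \<Longrightarrow> continuous_on A f"
  by (meson DERIV_isCont continuous_at_imp_continuous_on smooth_DERIV)

text \<open>Products of smooth functions are not stable under \<open>deriv\<close>, since the
  Leibniz rule produces a sum of two of them; finite sums of products are.\<close>

inductive product_sum :: "(real \<Rightarrow> real) \<Rightarrow> bool" where
  product_sum_mult: "smooth f \<Longrightarrow> smooth g \<Longrightarrow> product_sum (\<lambda>x. f x * g x)"
| product_sum_add: "product_sum f \<Longrightarrow> product_sum g \<Longrightarrow> product_sum (\<lambda>x. f x + g x)"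

lemma product_sum_deriv: "product_sum h \<Longrightarrow> \<exists>h'. product_sum h' \<and> (\<forall>x. (h
    has_real_derivative h' x) (at x))"
proof (induction rule: product_sum.induct)
  case (product_sum_mult f g)
  then have "product_sum (\<lambda>x. deriv f x * g x + f x * deriv g x)"
    by (intro product_sum.intros smooth_deriv)
  moreover have "((\<lambda>x. f x * g x) has_real_derivative (deriv f x * g x + f x * deriv g x)) (at x)" for x
    using product_sum_mult by (auto intro!: derivative_eq_intros smooth_DERIV)
  ultimately show ?case by blast
next
  case (product_sum_add f g)
  then obtain f' g' where "product_sum f'" "\<And>x. (f has_real_derivative f' x) (at x)"
    "product_sum g'" "\<And>x. (g has_real_derivative g' x) (at x)" by auto
  then have "product_sum (\<lambda>x. f' x + g' x)" "\<And>x. ((\<lambda>x. f x + g x)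
      has_real_derivative (f' x + g' x)) (at x)"
    by (auto intro: product_sum.intros DERIV_add)
  then show ?case by blast
qed

lemma product_sum_smooth: "product_sum h \<Longrightarrow> smooth h"
proof (rule smooth_coinduct[of product_sum])
  fix g assume "product_sum g"
  then obtain g' where g': "product_sum g'" "\<And>x. (g has_real_derivative g' x) (at x)"
    using product_sum_deriv by blast
  then have "deriv g = g'" by (auto intro: DERIV_imp_deriv)
  then show "(\<forall>x. g field_differentiable at x) \<and> product_sum (deriv g)"
    using g' by (auto simp: field_differentiable_def)
qed

lemma smooth_mult: "smooth f \<Longrightarrow> smooth g \<Longrightarrow> smooth (\<lambda>x. f x * g x)"
  by (rule product_sum_smooth[OF product_sum_mult])

lemma smooth_const: "smooth (\<lambda>x. c)"
  by (rule smooth_coinduct[where S="\<lambda>h. \<exists>c. h = (\<lambda>x. c)"]) auto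

lemma smooth_add:
  assumes "smooth f" "smooth g"
  shows "smooth (\<lambda>x. f x + g x)"
  using product_sum_smooth[OF product_sum_add[OF product_sum_mult product_sum_mult], OF
      smooth_const[of 1] assms(1) smooth_const[of 1] assms(2)]
  by simp

lemma smooth_diff:
  assumes "smooth f" "smooth g"
  shows "smooth (\<lambda>x. f x - g x)"
  using smooth_add[OF assms(1) smooth_mult[OF smooth_const[of "-1"] assms(2)]] by simp

lemma smooth_affine:
  assumes "smooth f"
  shows "smooth (\<lambda>x. f (a * x + b))"
proof (rule smooth_coinduct[where S="\<lambda>h. \<exists>c g. smooth g \<and> h = (\<lambda>x. c * g (a * x + b))"])
  show "\<exists>c g. smooth g \<and> (\<lambda>x. f (a * x + b)) = (\<lambda>x. c * g (a * x + b))"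
    using assms by (intro exI[of _ 1] exI[of _ f]) auto
  fix h assume "\<exists>c g. smooth g \<and> h = (\<lambda>x. c * g (a * x + b))"
  then obtain c g where g: "smooth g" "h = (\<lambda>x. c * g (a * x + b))" by blast
  have d: "(h has_real_derivative (c * a) * deriv g (a * x + b)) (at x)" for x
    unfolding g(2) by (rule derivative_eq_intros DERIV_chain2[OF smooth_DERIV[OF g(1)]] refl)+ simp
  then have "deriv h = (\<lambda>x. (c * a) * deriv g (a * x + b))" by (auto intro: DERIV_imp_deriv)
  then show "(\<forall>x. h field_differentiable at x) \<and> (\<exists>c g. smooth g \<and> deriv h = (\<lambda>x. c * g (a * x + b)))"
    using d smooth_deriv[OF g(1)] by (auto simp: field_differentiable_def)
qed

lemma smooth_shift:
  assumes "smooth f"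
  shows "smooth (\<lambda>x. f (x + b))" "deriv (\<lambda>x. f (x + b)) = (\<lambda>x. deriv f (x + b))"
proof -
  have "((\<lambda>x. f (x + b)) has_real_derivative deriv f (x + b)) (at x)" for x
    using smooth_DERIV[OF assms, of "x + b"] by (simp add: DERIV_shift)
  moreover have "smooth (\<lambda>x. deriv f (x + b))"
    using smooth_affine[OF smooth_deriv[OF assms], of 1 b] by simp
  ultimately show "smooth (\<lambda>x. f (x + b))" "deriv (\<lambda>x. f (x + b)) = (\<lambda>x. deriv f (x + b))"
    by (rule smooth_of_DERIV)+
qed

section \<open>Flat functions and smooth approximations of indicators\<close>

definition half_exp :: "real poly \<Rightarrow> real \<Rightarrow> real" where
  "half_exp P x = (if x > 0 then poly P (1 / x) * exp (- (1 / x)) else 0)"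

lemma poly_exp_tendsto_0: "((\<lambda>t. poly P t * exp (- t)) \<longlongrightarrow> (0::real)) at_top"
proof -
  have "((\<lambda>t. \<Sum>i\<le>degree P. coeff P i * (t ^ i / exp t)) \<longlongrightarrow> (\<Sum>i\<le>degree P. coeff P i * 0)) at_top"
    by (intro tendsto_intros tendsto_power_div_exp_0)
  then show ?thesis
    by (simp add: poly_altdef sum_distrib_right exp_minus divide_inverse mult.assoc)
qed

text \<open>With \<open>t = 1 / x\<close>, differentiating \<open>P(t) * exp (-t)\<close> gives
  \<open>t^2 * (P'(t) * (-1) + P(t)) * exp (-t)\<close>, and \<open>[:0, 0, 1:]\<close> is
  \<open>t^2\<close>. The polynomial factor is carried along so that the family is stable under
  \<open>deriv\<close>.\<close>

lemma half_exp_deriv: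
  "(half_exp P has_real_derivative half_exp ([:0, 0, 1:] * (P - pderiv P)) x) (at x)"
proof -
  consider "x > 0" | "x < 0" | "x = 0" by linarith
  then show ?thesis
  proof cases
    case 1
    have "((\<lambda>x. poly P (1 / x) * exp (- (1 / x))) has_real_derivative
        (poly (pderiv P) (1 / x) * (- 1 / x\<^sup>2) * exp (- (1 / x)) + poly P (1 / x) * (exp (- (1 / x))
            * (1 / x\<^sup>2)))) (at x)"
      using 1 by (auto intro!: derivative_eq_intros DERIV_chain2[OF poly_DERIV] simp: power2_eq_square)
    moreover have "(poly (pderiv P) (1 / x) * (- 1 / x\<^sup>2) * exp (- (1 / x)) + poly P (1 / x)
        * (exp (- (1 / x)) * (1 / x\<^sup>2)))
        = half_exp ([:0, 0, 1:] * (P - pderiv P)) x"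
      using 1 by (simp add: half_exp_def power2_eq_square field_simps)
    ultimately have "((\<lambda>x. poly P (1 / x) * exp (- (1 / x))) has_real_derivative
        half_exp ([:0, 0, 1:] * (P - pderiv P)) x) (at x)" by simp
    then show ?thesis
      by (rule has_field_derivative_transform_within_open[of _ _ _ "{0<..}"])
        (use 1 in \<open>auto simp: half_exp_def\<close>)
  next
    case 2
    have "((\<lambda>x. 0) has_real_derivative half_exp ([:0, 0, 1:] * (P - pderiv P)) x) (at x)"
      using 2 by (simp add: half_exp_def)
    then show ?thesis
      by (rule has_field_derivative_transform_within_open[of _ _ _ "{..<0}"])
        (use 2 in \<open>auto simp: half_exp_def\<close>)
  next
    case 3
    \<comment> \<open>At \<open>0\<close> the difference quotient is
      \<open>t * P(t) * exp (-t)\<close> with \<open>t = 1 / y\<close>; the polynomial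
      \<open>pCons 0 P\<close> absorbs the extra factor \<open>t\<close>.\<close>
    have "((\<lambda>y. poly (pCons 0 P) (inverse y) * exp (- inverse y)) \<longlongrightarrow> 0) (at_right 0)"
      by (rule filterlim_compose[OF poly_exp_tendsto_0 filterlim_inverse_at_top_right])
    then have right: "((\<lambda>y. half_exp P y / y) \<longlongrightarrow> 0) (at_right 0)"
      by (rule Lim_transform_eventually)
        (auto intro!: eventually_mono[OF eventually_at_right_less] simp: half_exp_def divide_inverse
            mult_ac)
    have "\<forall>\<^sub>F y in at_left 0. half_exp P y / y = 0"
      by (auto simp: half_exp_def eventually_at_filter)
    then have left: "((\<lambda>y. half_exp P y / y) \<longlongrightarrow> 0) (at_left 0)"
      by (rule tendsto_eventually)
    have "((\<lambda>y. half_exp P y / y) \<longlongrightarrow> 0) (at 0)"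
      by (rule filterlim_split_at[OF left right])
    then show ?thesis
      unfolding 3 has_field_derivative_iff by (simp add: half_exp_def)
  qed
qed

lemma smooth_half_exp: "smooth (half_exp P)"
proof (rule smooth_coinduct[where S="\<lambda>h. \<exists>P. h = half_exp P"])
  fix h assume "\<exists>P. h = half_exp P"
  then obtain P where h: "h = half_exp P" by blast
  have "deriv h = half_exp ([:0, 0, 1:] * (P - pderiv P))"
    unfolding h by (intro ext DERIV_imp_deriv half_exp_deriv)
  then show "(\<forall>x. h field_differentiable at x) \<and> (\<exists>P. deriv h = half_exp P)"
    using half_exp_deriv[of P] unfolding h by (auto simp: field_differentiable_def)
qed blast

text \<open>Stretching the flat function \<open>exp (-1 / x)\<close> by \<open>Suc j\<close> drives
  each factor to \<open>1\<close> at every interior point while the support stays in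
  \<open>[a, b]\<close>.\<close>

definition bump :: "real \<Rightarrow> real \<Rightarrow> nat \<Rightarrow> real \<Rightarrow> real" where
  "bump a b j x = half_exp 1 (real (Suc j) * (x - a)) * half_exp 1 (real (Suc j) * (b - x))"

lemma half_exp_1_bounds: "0 \<le> half_exp 1 x" "half_exp 1 x \<le> 1"
  by (simp_all add: half_exp_def)

lemma bump_bounds: "0 \<le> bump a b j x" "bump a b j x \<le> indicator {a..b} x"
proof -
  show "0 \<le> bump a b j x" by (simp add: bump_def half_exp_1_bounds)
  show "bump a b j x \<le> indicator {a..b} x"
  proof (cases "x \<in> {a..b}")
    case True
    then show ?thesis using half_exp_1_bounds by (simp add: bump_def mult_le_one)
  next
    case False
    then have "bump a b j x = 0"
      by (auto simp: bump_def half_exp_def zero_less_mult_iff simp del: of_nat_Suc)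
    then show ?thesis by simp
  qed
qed

lemma test_fun_bump: "test_fun (bump a b j)"
  unfolding test_fun_iff
proof
  have "bump a b j = (\<lambda>x. half_exp 1 (real (Suc j) * x + (- real (Suc j) * a))
      * half_exp 1 ((- real (Suc j)) * x + real (Suc j) * b))"
    unfolding bump_def fun_eq_iff by (intro allI arg_cong2[where f="(*)"] arg_cong[where f="half_exp
        1"]) argo+
  then show "smooth (bump a b j)"
    by (simp only:) (intro smooth_mult smooth_affine smooth_half_exp)
  have "{x. bump a b j x \<noteq> 0} \<subseteq> {a..b}"
  proof
    fix x assume "x \<in> {x. bump a b j x \<noteq> 0}"
    then show "x \<in> {a..b}" using bump_bounds[of a b j x] by (cases "x \<in> {a..b}") auto
  qed
  then show "bounded {x. bump a b j x \<noteq> 0}"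
    by (rule bounded_subset[rotated]) simp
qed

lemma bump_tendsto: "(\<lambda>j. bump a b j x) \<longlonglongrightarrow> indicator {a<..<b} x"
proof (cases "x \<in> {a<..<b}")
  case True
  have *: "(\<lambda>j. half_exp 1 (real (Suc j) * d)) \<longlonglongrightarrow> 1" if "d > 0" for d
  proof -
    have "(\<lambda>j. exp (- (1 / d * inverse (real (Suc j))))) \<longlonglongrightarrow> exp (- (1 / d * 0))"
      by (intro tendsto_intros LIMSEQ_inverse_real_of_nat)
    moreover have "exp (- (1 / d * inverse (real (Suc j)))) = half_exp 1 (real (Suc j) * d)" for j
      using that by (simp add: half_exp_def field_simps del: of_nat_Suc)
    ultimately show ?thesis by simp
  qed
  have "(\<lambda>j. half_exp 1 (real (Suc j) * (x - a)) * half_exp 1 (real (Suc j) * (b - x))) \<longlonglongrightarrow> 1 * 1"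
    using True by (intro tendsto_mult *) auto
  then show ?thesis using True by (simp add: bump_def)
next
  case False
  then have "bump a b j x = 0" for j
    by (auto simp: bump_def half_exp_def zero_less_mult_iff simp del: of_nat_Suc)
  then show ?thesis using False by simp
qed

lemma test_fun_deriv: "test_fun \<phi> \<Longrightarrow> test_fun (deriv \<phi>)"
  unfolding test_fun_iff
proof
  assume a: "smooth \<phi> \<and> bounded {x. \<phi> x \<noteq> 0}"
  show "smooth (deriv \<phi>)" using a by (simp add: smooth_deriv)
  have "{x. deriv \<phi> x \<noteq> 0} \<subseteq> closure {x. \<phi> x \<noteq> 0}"
  proof (intro subsetI, rule ccontr)
    fix x assume x: "x \<in> {x. deriv \<phi> x \<noteq> 0}" "x \<notin> closure {x. \<phi> x \<noteq> 0}"
    have "((\<lambda>x. 0) has_real_derivative 0) (at x)" by simp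
    then have "(\<phi> has_real_derivative 0) (at x)"
      by (rule has_field_derivative_transform_within_open[of _ _ _ "- closure {x. \<phi> x \<noteq> 0}"])
        (use x closure_subset[of "{x. \<phi> x \<noteq> 0}"] in auto)
    then show False using x DERIV_imp_deriv by force
  qed
  then show "bounded {x. deriv \<phi> x \<noteq> 0}"
    using a bounded_closure bounded_subset by blast
qed

lemma test_fun_shift: "test_fun \<phi> \<Longrightarrow> test_fun (\<lambda>x. \<phi> (x + b))"
proof -
  assume a: "test_fun \<phi>"
  have "{x. \<phi> (x + b) \<noteq> 0} = (\<lambda>x. x - b) ` {x. \<phi> x \<noteq> 0}"
    by (auto intro!: image_eqI[of _ _ "_ + b"])
  then show ?thesis
    using a smooth_shift(1)[of \<phi> b] bounded_translation_minus[of "{x. \<phi> x \<noteq> 0}" b]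
    by (simp add: test_fun_iff)
qed

lemma test_fun_bounds:
  assumes "test_fun \<phi>"
  obtains R B where "R > 0" "B \<ge> 0" "\<And>x. \<bar>\<phi> x\<bar> \<le> B * indicator {-R..R} x"
proof -
  obtain R where R: "R > 0" "\<And>x. \<phi> x \<noteq> 0 \<Longrightarrow> \<bar>x\<bar> \<le> R"
    using assms unfolding test_fun_iff bounded_pos by auto
  have "bounded (\<phi> ` {-R..R})"
    using assms by (intro compact_imp_bounded compact_continuous_image smooth_continuous) (auto
        simp: test_fun_iff)
  then obtain B where B: "\<And>x. x \<in> {-R..R} \<Longrightarrow> \<bar>\<phi> x\<bar> \<le> B"
    unfolding bounded_iff real_norm_def by blast
  show ?thesis
  proof (rule that[OF R(1)])
    show "B \<ge> 0" using B[of 0] R(1) by auto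
    fix x show "\<bar>\<phi> x\<bar> \<le> B * indicator {-R..R} x"
      using B[of x] R(2)[of x] by (cases "x \<in> {-R..R}"; cases "\<phi> x = 0") (auto simp: abs_le_iff)
  qed
qed

text \<open>The primitive supplied to the weak derivative to turn it into a difference.\<close>

lemma window_primitive:
  assumes \<psi>: "test_fun \<psi>" and "h > 0"
  defines "\<phi> \<equiv> \<lambda>x. integral {x - h..x} \<psi>"
  shows "test_fun \<phi>" "deriv \<phi> = (\<lambda>x. \<psi> x - \<psi> (x - h))"
proof -
  have sm: "smooth \<psi>" using \<psi> by (simp add: test_fun_iff)
  obtain F where F: "\<And>x. (F has_vector_derivative \<psi> x) (at x)"
    using einterval_antiderivative[of "-\<infinity>" \<infinity> \<psi>] smooth_continuous[OF sm, of UNIV]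
    by (auto simp: continuous_on_eq_continuous_at)
  \<comment> \<open>The antiderivative \<open>F\<close> need not have compact support, but its
    difference over a window does, since the window misses the support of \<open>\<psi>\<close> when
    \<open>x\<close> is far out.\<close>
  have \<phi>: "\<phi> x = F x - F (x - h)" for x
    unfolding \<phi>_def using \<open>h > 0\<close> F
    by (intro integral_unique fundamental_theorem_of_calculus) (auto intro:
        has_vector_derivative_at_within)
  have dF: "(F has_real_derivative \<psi> x) (at x)" for x
    using F by (simp add: has_real_derivative_iff_has_vector_derivative)
  have "(\<phi> has_real_derivative (\<psi> x - \<psi> (x - h))) (at x)" for x
  proof -
    have "((\<lambda>x. F (x + (- h))) has_real_derivative \<psi> (x + (- h))) (at x)"
      using dF[of "x + (- h)"] by (simp only: DERIV_shift)
    from DERIV_diff[OF dF this] show ?thesis by (simp add: \<phi>[abs_def])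
  qed
  moreover have "smooth (\<lambda>x. \<psi> x - \<psi> (x - h))"
    using smooth_diff[OF sm smooth_shift(1)[OF sm, of "-h"]] by simp
  ultimately have s: "smooth \<phi>" "deriv \<phi> = (\<lambda>x. \<psi> x - \<psi> (x - h))"
    by (rule smooth_of_DERIV)+
  then show "deriv \<phi> = (\<lambda>x. \<psi> x - \<psi> (x - h))" by simp
  obtain R B where R: "\<And>x. \<bar>\<psi> x\<bar> \<le> B * indicator {-R..R} x"
    using test_fun_bounds[OF \<psi>] by metis
  have "\<phi> x = 0" if "x \<notin> {-R..R + h}" for x
  proof -
    have "\<psi> y = 0" if "y \<in> {x - h..x}" for y
      using R[of y] that \<open>x \<notin> _\<close> \<open>h > 0\<close> by (auto simp: indicator_def split: if_splits)
    then have "integral {x - h..x} \<psi> = integral {x - h..x} (\<lambda>_. 0)"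
      by (intro integral_cong) auto
    then show ?thesis by (simp add: \<phi>_def)
  qed
  then have "{x. \<phi> x \<noteq> 0} \<subseteq> {-R..R + h}" by blast
  then have "bounded {x. \<phi> x \<noteq> 0}" by (rule bounded_subset[rotated]) simp
  then show "test_fun \<phi>" using s by (simp add: test_fun_iff)
qed

subsection \<open>Square integrable functions and weak derivatives\<close>

lemma L2_measurable: "f \<in> L2 \<Longrightarrow> f \<in> borel_measurable borel"
  by (simp add: L2_def)

lemma L2_sq_integrable: "f \<in> L2 \<Longrightarrow> integrable lborel (\<lambda>x. (f x)\<^sup>2)"
  by (simp add: L2_def)

lemma L2_shift:
  assumes "f \<in> L2"
  shows "(\<lambda>x. f (x + h)) \<in> L2"
proof -
  have [measurable]: "f \<in> borel_measurable borel" by (rule L2_measurable[OF assms])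
  have "integrable lborel (\<lambda>x. (f (h + 1 * x))\<^sup>2)"
    by (rule lborel_integrable_real_affine[OF L2_sq_integrable[OF assms]]) simp
  then show ?thesis by (simp add: L2_def add.commute)
qed

lemma L2_diff:
  assumes "f \<in> L2" "g \<in> L2"
  shows "(\<lambda>x. f x - g x) \<in> L2"
proof -
  have [measurable]: "f \<in> borel_measurable borel" "g \<in> borel_measurable borel"
    using assms by (auto intro: L2_measurable)
  have "integrable lborel (\<lambda>x. 2 * (f x)\<^sup>2 + 2 * (g x)\<^sup>2)"
    using assms by (intro Bochner_Integration.integrable_add integrable_mult_right L2_sq_integrable)
  then have "integrable lborel (\<lambda>x. (f x - g x)\<^sup>2)"
  proof (rule Bochner_Integration.integrable_bound)
    have "norm ((f x - g x)\<^sup>2) \<le> norm (2 * (f x)\<^sup>2 + 2 * (g x)\<^sup>2)" for x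
    proof -
      have "(f x - g x)\<^sup>2 + (f x + g x)\<^sup>2 = 2 * (f x)\<^sup>2 + 2 * (g x)\<^sup>2"
        by (simp add: power2_sum power2_diff)
      then have "(f x - g x)\<^sup>2 \<le> 2 * (f x)\<^sup>2 + 2 * (g x)\<^sup>2"
        using zero_le_power2[of "f x + g x"] by linarith
      then show ?thesis by simp
    qed
    then show "AE x in lborel. norm ((f x - g x)\<^sup>2) \<le> norm (2 * (f x)\<^sup>2 + 2 * (g x)\<^sup>2)" by simp
  qed simp
  then show ?thesis by (simp add: L2_def)
qed

lemma L2_set_integrable:
  assumes "f \<in> L2"
  shows "set_integrable lborel {a..b} f"
  unfolding set_integrable_def
proof (rule Bochner_Integration.integrable_bound)
  have [measurable]: "f \<in> borel_measurable borel" by (rule L2_measurable[OF assms])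
  show "integrable lborel (\<lambda>x. indicator {a..b} x + (f x)\<^sup>2)"
    using assms by (intro Bochner_Integration.integrable_add L2_sq_integrable integrable_real_indicator)
      (auto simp: emeasure_lborel_Icc_eq)
  have "\<bar>y\<bar> \<le> 1 + y\<^sup>2" for y :: real
    using zero_le_power2[of "\<bar>y\<bar> - 1"] by (simp add: power2_diff)
  then have "norm (indicator {a..b} x *\<^sub>R f x) \<le> norm (indicator {a..b} x + (f x)\<^sup>2)" for x
    by (auto simp: indicator_def abs_of_nonneg)
  then show "AE x in lborel. norm (indicator {a..b} x *\<^sub>R f x) \<le> norm (indicator {a..b} x + (f x)\<^sup>2)"
    by simp
qed (use L2_measurable[OF assms] in simp)

lemma L2_abs: "f \<in> L2 \<Longrightarrow> (\<lambda>x. \<bar>f x\<bar>) \<in> L2"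
  by (simp add: L2_def borel_measurable_abs)

lemma L2_integrable_on: "f \<in> L2 \<Longrightarrow> f integrable_on {a..b}"
  by (rule set_borel_integral_eq_integral(1)[OF L2_set_integrable])

lemma test_fun_measurable: "test_fun \<phi> \<Longrightarrow> \<phi> \<in> borel_measurable borel"
  by (intro borel_measurable_continuous_onI smooth_continuous) (simp add: test_fun_iff)

lemma L2_test_integrable:
  assumes "f \<in> L2" "test_fun \<phi>"
  shows "integrable lborel (\<lambda>x. f x * \<phi> x)"
proof -
  obtain R B where B: "B \<ge> 0" "\<And>x. \<bar>\<phi> x\<bar> \<le> B * indicator {-R..R} x"
    using test_fun_bounds[OF assms(2)] by metis
  have "integrable lborel (\<lambda>x. B * (indicator {-R..R} x *\<^sub>R f x))"
    using L2_set_integrable[OF assms(1), of "-R" R]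
        by (intro integrable_mult_right) (simp add: set_integrable_def)
  then show ?thesis
  proof (rule Bochner_Integration.integrable_bound)
    have "norm (f x * \<phi> x) \<le> norm (B * (indicator {-R..R} x *\<^sub>R f x))" for x
      using mult_right_mono[OF B(2)[of x], of "\<bar>f x\<bar>"] B(1) by (simp add: abs_mult mult_ac)
    then show "AE x in lborel. norm (f x * \<phi> x) \<le> norm (B * (indicator {-R..R} x *\<^sub>R f x))" by simp
  qed (use L2_measurable[OF assms(1)] test_fun_measurable[OF assms(2)] in simp)
qed

section \<open>Differences of step \<open>h\<close> and weak derivatives\<close>

definition shift_diff :: "real \<Rightarrow> (real \<Rightarrow> real) \<Rightarrow> real \<Rightarrow> real" where
  "shift_diff h f x = f (x + h) - f x"

lemma L2_shift_diff: "f \<in> L2 \<Longrightarrow> shift_diff h f \<in> L2"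
  unfolding shift_diff_def by (intro L2_diff L2_shift)

lemma lborel_integral_shift: "(LINT x|lborel. f (x + h)) = (LINT x|lborel. f x :: real)" for h :: real
  using lborel_integral_real_affine[of 1 f h] by (simp add: add.commute)

lemma integral_shift_diff_test:
  assumes "f \<in> L2" "test_fun \<phi>"
  shows "(LINT x|lborel. shift_diff h f x * \<phi> x)
      = (LINT x|lborel. f x * \<phi> (x - h)) - (LINT x|lborel. f x * \<phi> x)"
proof -
  have "(LINT x|lborel. shift_diff h f x * \<phi> x)
      = (LINT x|lborel. f (x + h) * \<phi> x) - (LINT x|lborel. f x * \<phi> x)"
    unfolding shift_diff_def left_diff_distrib
    using assms by (intro Bochner_Integration.integral_diff L2_test_integrable L2_shift)
  also have "(LINT x|lborel. f (x + h) * \<phi> x) = (LINT x|lborel. f x * \<phi> (x - h))"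
    using lborel_integral_shift[of "\<lambda>x. f x * \<phi> (x - h)" h] by simp
  finally show ?thesis .
qed

lemma test_fun_shift_minus: "test_fun \<phi> \<Longrightarrow> test_fun (\<lambda>x. \<phi> (x - h))"
  using test_fun_shift[of \<phi> "-h"] by simp

lemma weak_deriv_1: "weak_deriv 1 f g \<longleftrightarrow>
    (\<forall>\<phi>. test_fun \<phi> \<longrightarrow> (LINT x|lborel. f x * deriv \<phi> x) = - (LINT x|lborel. g x * \<phi> x))"
  by (simp add: weak_deriv_def)

lemma weak_deriv_shift_diff:
  assumes "weak_deriv 1 f g" "f \<in> L2" "g \<in> L2"
  shows "weak_deriv 1 (shift_diff h f) (shift_diff h g)"
  unfolding weak_deriv_1
proof (intro allI impI)
  fix \<phi> assume \<phi>: "test_fun \<phi>"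
  have d: "deriv (\<lambda>x. \<phi> (x - h)) = (\<lambda>x. deriv \<phi> (x - h))"
    using smooth_shift(2)[of \<phi> "-h"] \<phi> by (simp add: test_fun_iff)
  have "(LINT x|lborel. f x * deriv (\<lambda>x. \<phi> (x - h)) x) = - (LINT x|lborel. g x * \<phi> (x - h))"
    "(LINT x|lborel. f x * deriv \<phi> x) = - (LINT x|lborel. g x * \<phi> x)"
    using assms(1) \<phi> test_fun_shift_minus[OF \<phi>, of h] unfolding weak_deriv_1 by blast+
  then show "(LINT x|lborel. shift_diff h f x * deriv \<phi> x) = - (LINT x|lborel. shift_diff h g x * \<phi> x)"
    using assms \<phi> by (simp add: integral_shift_diff_test test_fun_deriv d)
qed

text \<open>Testing the order \<open>k\<close> relation with \<open>deriv \<phi>\<close> reaches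
  order \<open>Suc k\<close>. This breaks an \<open>n\<close>-th weak derivative into first-order
  links, so that differences can be estimated one at a time.\<close>

lemma weak_deriv_chain:
  assumes "weak_deriv k f g" "weak_deriv (Suc k) f g'"
  shows "weak_deriv 1 g g'"
  unfolding weak_deriv_1
proof (intro allI impI)
  fix \<phi> assume \<phi>: "test_fun \<phi>"
  have "(-1) ^ k * (LINT x|lborel. g x * deriv \<phi> x) = (LINT x|lborel. f x * (deriv ^^ Suc k) \<phi> x)"
    using assms(1) test_fun_deriv[OF \<phi>] by (simp only: weak_deriv_def funpow_Suc_right o_apply)
  also have "\<dots> = (-1) ^ Suc k * (LINT x|lborel. g' x * \<phi> x)"
    using assms(2) \<phi> by (simp add: weak_deriv_def)
  finally have "(-1) ^ k * (LINT x|lborel. g x * deriv \<phi> x) = (-1) ^ k * - (LINT x|lborel. g' x * \<phi> x)"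
    by simp
  then show "(LINT x|lborel. g x * deriv \<phi> x) = - (LINT x|lborel. g' x * \<phi> x)"
    by (subst (asm) mult_left_cancel) auto
qed

text \<open>A fundamental theorem of calculus in averaged form. For a bump \<open>\<psi>\<close>
  close to the indicator of \<open>[a, b]\<close>, the window integral \<open>\<phi>\<close> has
  derivative \<open>\<psi> x - \<psi> (x - h)\<close>, so the weak derivative turns the pairing of
  the difference with \<open>\<psi>\<close> into the pairing of \<open>g\<close> with
  \<open>\<phi>\<close>. The factor \<open>b - a\<close> is divided out later as \<open>b\<close>
  tends to \<open>a\<close>.\<close>

lemma integral_shift_diff_le:
  assumes w: "weak_deriv 1 f g" and L2: "f \<in> L2" "g \<in> L2" and "a < b" "0 < h"
  shows "\<bar>integral {a..b} (shift_diff h f)\<bar> \<le> (b - a) * integral {a..b + h} (\<lambda>x. \<bar>g x\<bar>)"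
proof -
  define I where "I = integral {a..b + h} (\<lambda>x. \<bar>g x\<bar>)"
  have DL: "shift_diff h f \<in> L2" by (rule L2_shift_diff[OF L2(1)])
  have bound: "\<bar>LINT x|lborel. shift_diff h f x * bump a b j x\<bar> \<le> (b - a) * I" for j
  proof -
    let ?\<psi> = "bump a b j"
    define \<phi> where "\<phi> x = integral {x - h..x} ?\<psi>" for x
    have cont: "continuous_on A ?\<psi>" for A
      using test_fun_bump[of a b j] by (intro smooth_continuous) (simp add: test_fun_iff)
    have \<phi>: "test_fun \<phi>" "deriv \<phi> = (\<lambda>x. ?\<psi> x - ?\<psi> (x - h))"
      using window_primitive[OF test_fun_bump \<open>0 < h\<close>] by (auto simp: \<phi>_def[abs_def])
    have "(LINT x|lborel. f x * (?\<psi> x - ?\<psi> (x - h)))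
        = (LINT x|lborel. f x * ?\<psi> x) - (LINT x|lborel. f x * ?\<psi> (x - h))"
      unfolding right_diff_distrib
      by (intro Bochner_Integration.integral_diff L2_test_integrable L2 test_fun_bump
          test_fun_shift_minus)
    moreover have "(LINT x|lborel. f x * deriv \<phi> x) = - (LINT x|lborel. g x * \<phi> x)"
      using w \<phi>(1) unfolding weak_deriv_1 by blast
    ultimately have "(LINT x|lborel. shift_diff h f x * ?\<psi> x) = (LINT x|lborel. g x * \<phi> x)"
      using integral_shift_diff_test[OF L2(1) test_fun_bump, of h a b j] by (simp add: \<phi>(2))
    moreover have "\<bar>LINT x|lborel. g x * \<phi> x\<bar>
        \<le> (LINT x|lborel. (b - a) * (indicator {a..b + h} x *\<^sub>R \<bar>g x\<bar>))"
    proof -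
      \<comment> \<open>A window integral of \<open>?\<psi>\<close>, which is dominated by the
        indicator of \<open>[a, b]\<close>, is at most \<open>b - a\<close>, and it vanishes unless
        the window \<open>[x - h, x]\<close> meets \<open>[a, b]\<close>.\<close>
      have \<phi>_le: "\<bar>\<phi> x\<bar> \<le> (b - a) * indicator {a..b + h} x" for x
      proof -
        have ge: "0 \<le> \<phi> x"
          unfolding \<phi>_def by (intro integral_nonneg integrable_continuous_real cont) (simp add:
              bump_bounds)
        show ?thesis
        proof (cases "x \<in> {a..b + h}")
          case True
          have "((\<lambda>y. if y \<in> {a..b} then 1 else 0) has_integral (1 * (b - a))) UNIV"
            unfolding has_integral_restrict_UNIV using
                has_integral_const_real[of "1::real" a b] \<open>a < b\<close> by simp
          then have ind: "((\<lambda>y. indicator {a..b} y) has_integral (b - a)) UNIV"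
            by (simp add: indicator_def[abs_def] of_bool_def)
          have i1: "(\<lambda>y. indicator {a..b} y :: real) integrable_on {x - h..x}"
            using ind by (intro integrable_on_subinterval[of _ UNIV]) auto
          have "\<phi> x \<le> integral {x - h..x} (indicator {a..b})"
            unfolding \<phi>_def by (intro integral_le integrable_continuous_real cont i1) (simp add:
                bump_bounds)
          also have "\<dots> \<le> integral UNIV (indicator {a..b})"
            using i1 ind by (intro integral_subset_le) auto
          also have "\<dots> = b - a" using ind by (rule integral_unique)
          finally show ?thesis using True ge by simp
        next
          case False
          have "?\<psi> y = 0" if "y \<in> {x - h..x}" for y
            using bump_bounds[of a b j y] that False by (auto simp: indicator_def split: if_splits)
          then have "\<phi> x = integral {x - h..x} (\<lambda>_. 0)"
            unfolding \<phi>_def by (intro integral_cong) auto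
          then show ?thesis using False by simp
        qed
      qed
      have int: "integrable lborel (\<lambda>x. (b - a) * (indicator {a..b + h} x *\<^sub>R \<bar>g x\<bar>))"
        using L2_set_integrable[OF L2_abs[OF L2(2)]]
            by (intro integrable_mult_right) (simp add: set_integrable_def)
      have "\<bar>LINT x|lborel. g x * \<phi> x\<bar> \<le> (LINT x|lborel. norm (g x * \<phi> x))"
        using integral_norm_bound[of lborel "\<lambda>x. g x * \<phi> x"] by simp
      also have "\<dots> \<le> (LINT x|lborel. (b - a) * (indicator {a..b + h} x *\<^sub>R \<bar>g x\<bar>))"
      proof (rule integral_mono)
        show "integrable lborel (\<lambda>x. norm (g x * \<phi> x))"
          by (intro integrable_norm L2_test_integrable L2 \<phi>(1))
        show "norm (g x * \<phi> x) \<le> (b - a) * (indicator {a..b + h} x *\<^sub>R \<bar>g x\<bar>)" for x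
          using mult_right_mono[OF \<phi>_le[of x], of "\<bar>g x\<bar>"] by (simp add: abs_mult mult_ac)
      qed (rule int)
      finally show ?thesis .
    qed
    moreover have "(LINT x|lborel. (b - a) * (indicator {a..b + h} x *\<^sub>R \<bar>g x\<bar>)) = (b - a) * I"
      using set_borel_integral_eq_integral(2)[OF L2_set_integrable[OF L2_abs[OF L2(2)]], of a "b + h"]
      by (simp add: I_def set_lebesgue_integral_def)
    ultimately show ?thesis by (simp only:)
  qed
  have "(\<lambda>j. LINT x|lborel. shift_diff h f x * bump a b j x) \<longlonglongrightarrow> (LINT x|lborel. indicator {a..b} x
      * shift_diff h f x)"
  proof (rule integral_dominated_convergence)
    have [measurable]: "shift_diff h f \<in> borel_measurable borel" by (rule L2_measurable[OF DL])
    show "(\<lambda>x. indicator {a..b} x * shift_diff h f x) \<in> borel_measurable lborel" by simp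
    show "(\<lambda>x. shift_diff h f x * bump a b j x) \<in> borel_measurable lborel" for j
      using test_fun_measurable[OF test_fun_bump[of a b j]] by simp
    show "integrable lborel (\<lambda>x. indicator {a..b} x *\<^sub>R \<bar>shift_diff h f x\<bar>)"
      using L2_set_integrable[OF L2_abs[OF DL]] by (simp add: set_integrable_def)
    show "AE x in lborel. norm (shift_diff h f x * bump a b j x)
        \<le> indicator {a..b} x *\<^sub>R \<bar>shift_diff h f x\<bar>" for j
    proof (rule AE_I2)
      fix x
      have "\<bar>bump a b j x\<bar> \<le> indicator {a..b} x" using bump_bounds[of a b j x] by simp
      from mult_right_mono[OF this, of "\<bar>shift_diff h f x\<bar>"]
      show "norm (shift_diff h f x * bump a b j x) \<le> indicator {a..b} x *\<^sub>R \<bar>shift_diff h f x\<bar>"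
        by (simp add: abs_mult mult_ac)
    qed
    \<comment> \<open>The bumps converge to the indicator of the open interval; the closed one
      differs only at the two endpoints.\<close>
    have "AE x in lborel. x \<noteq> a \<and> x \<noteq> b"
      using AE_lborel_singleton[of a] AE_lborel_singleton[of b] by (rule AE_conjI)
    then show "AE x in lborel. (\<lambda>j. shift_diff h f x * bump a b j x) \<longlonglongrightarrow> indicator {a..b} x
        * shift_diff h f x"
    proof (rule eventually_mono)
      fix x assume "x \<noteq> a \<and> x \<noteq> b"
      then have "indicator {a..b} x = (indicator {a<..<b} x :: real)" by (auto simp: indicator_def)
      then show "(\<lambda>j. shift_diff h f x * bump a b j x) \<longlonglongrightarrow> indicator {a..b} x * shift_diff h f x"
        using tendsto_mult[OF tendsto_const bump_tendsto[of a b x], of "shift_diff h f x"]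
            by (simp add: mult.commute)
    qed
  qed
  then have "(\<lambda>j. \<bar>LINT x|lborel. shift_diff h f x
      * bump a b j x\<bar>) \<longlonglongrightarrow> \<bar>LINT x|lborel. indicator {a..b} x * shift_diff h f x\<bar>"
    by (rule tendsto_rabs)
  then have "\<bar>LINT x|lborel. indicator {a..b} x * shift_diff h f x\<bar> \<le> (b - a) * I"
    by (rule tendsto_upperbound) (intro always_eventually allI bound, simp)
  moreover have "(LINT x|lborel. indicator {a..b} x * shift_diff h f x)
      = integral {a..b} (shift_diff h f)"
    using set_borel_integral_eq_integral(2)[OF L2_set_integrable[OF DL], of a b]
    by (simp add: set_lebesgue_integral_def)
  ultimately show ?thesis by (simp add: I_def)
qed

lemma AE_lebesgue_point:
  fixes f :: "real \<Rightarrow> real"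
  assumes "\<And>a b. f integrable_on {a..b}"
  shows "AE x in lborel. ((\<lambda>h. integral {x..x + h} f / h) \<longlongrightarrow> f x) (at_right 0)"
proof -
  have "f integrable_on cbox a b" for a b using assms by simp
  then obtain N where N: "negligible N"
    "\<And>x e. \<lbrakk>x \<notin> N; 0 < e\<rbrakk> \<Longrightarrow> \<exists>d>0. \<forall>h. 0 < h \<and> h < d \<longrightarrow>
       norm (integral (cbox x (x + h *\<^sub>R One)) f /\<^sub>R h ^ DIM(real) - f x) < e"
    using integrable_ccontinuous_explicit[of f] by blast
  have "((\<lambda>h. integral {x..x + h} f / h) \<longlongrightarrow> f x) (at_right 0)" if nx: "x \<notin> N" for x
  proof (rule tendstoI)
    fix e :: real assume "0 < e"
    then obtain d where "d > 0" "\<forall>h. 0 < h \<and> h < d \<longrightarrow>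
       norm (integral (cbox x (x + h *\<^sub>R One)) f /\<^sub>R h ^ DIM(real) - f x) < e"
      using N(2)[OF nx] by blast
    then show "\<forall>\<^sub>F h in at_right 0. dist (integral {x..x + h} f / h) (f x) < e"
      unfolding eventually_at_right_field
      by (intro exI[of _ d]) (auto simp: dist_norm divide_inverse mult.commute)
  qed
  moreover have "AE x in lebesgue. x \<notin> N"
    using N(1) by (intro AE_not_in) (simp add: negligible_iff_null_sets)
  ultimately have "AE x in lebesgue. ((\<lambda>h. integral {x..x + h} f / h) \<longlongrightarrow> f x) (at_right 0)"
    by (auto elim: eventually_mono)
  then show ?thesis by (simp add: AE_completion_iff)
qed

text \<open>No continuous representative of \<open>f\<close> is chosen. The averaged bound is
  applied on \<open>[x, x + r]\<close>, divided by \<open>r\<close>, and \<open>r\<close> tends to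
  \<open>0\<close> at a Lebesgue point of the difference; the right side is continuous in its upper
  endpoint.\<close>

lemma AE_shift_diff_le:
  assumes w: "weak_deriv 1 f g" and L2: "f \<in> L2" "g \<in> L2" and "0 < h"
  shows "AE x in lborel. \<bar>shift_diff h f x\<bar> \<le> integral {x..x + h} (\<lambda>x. \<bar>g x\<bar>)"
proof -
  have DL: "shift_diff h f \<in> L2" by (rule L2_shift_diff[OF L2(1)])
  have "\<bar>shift_diff h f x\<bar> \<le> integral {x..x + h} (\<lambda>x. \<bar>g x\<bar>)"
    if lim: "((\<lambda>r. integral {x..x + r} (shift_diff h f) / r) \<longlongrightarrow> shift_diff h f x) (at_right 0)" for x
  proof (rule tendsto_le[OF _ _ tendsto_rabs[OF lim]])
    have "continuous_on {x..x + h + 1} (\<lambda>y. integral {x..y} (\<lambda>x. \<bar>g x\<bar>))"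
      by (intro indefinite_integral_continuous_1 L2_integrable_on L2_abs L2)
    then have "continuous_on {0..1} (\<lambda>r. integral {x..x + r + h} (\<lambda>x. \<bar>g x\<bar>))"
      by (rule continuous_on_compose2[of _ _ _ "\<lambda>r. x + r
          + h"]) (use \<open>0 < h\<close> in \<open>auto intro!: continuous_intros\<close>)
    then have "((\<lambda>r. integral {x..x + r + h} (\<lambda>x. \<bar>g x\<bar>))
        \<longlongrightarrow> integral {x..x + 0 + h} (\<lambda>x. \<bar>g x\<bar>)) (at 0 within {0..1})"
      unfolding continuous_on_def by (rule bspec) simp
    then have "((\<lambda>r. integral {x..x + r + h} (\<lambda>x. \<bar>g x\<bar>))
        \<longlongrightarrow> integral {x..x + 0 + h} (\<lambda>x. \<bar>g x\<bar>)) (at_right 0)"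
      by (simp add: at_within_Icc_at_right)
    then show "((\<lambda>r. integral {x..x + r + h} (\<lambda>x. \<bar>g x\<bar>))
        \<longlongrightarrow> integral {x..x + h} (\<lambda>x. \<bar>g x\<bar>)) (at_right 0)"
      by simp
    show "\<forall>\<^sub>F r in at_right 0. \<bar>integral {x..x + r} (shift_diff h f) / r\<bar>
        \<le> integral {x..x + r + h} (\<lambda>x. \<bar>g x\<bar>)"
      using eventually_at_right_less[of 0]
    proof eventually_elim
      case (elim r)
      then show ?case
        using integral_shift_diff_le[OF w L2 _ \<open>0 < h\<close>, of x "x + r"]
            by (simp add: abs_divide field_simps)
    qed
  qed simp
  then show ?thesis
    using AE_lebesgue_point[OF L2_integrable_on[OF DL]] by (auto elim: eventually_mono)
qed

text \<open>Takes values in \<open>ennreal\<close> so that integrals and sums can be exchanged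
  without integrability checks.\<close>

definition sq_mass :: "(real \<Rightarrow> real) \<Rightarrow> ennreal" where
  "sq_mass f = (\<integral>\<^sup>+x. ennreal ((f x)\<^sup>2) \<partial>lborel)"

lemma sq_mass_L2:
  assumes "f \<in> L2"
  shows "sq_mass f = ennreal ((L2_norm f)\<^sup>2)"
proof -
  have "sq_mass f = ennreal (LINT x|lborel. (f x)\<^sup>2)"
    unfolding sq_mass_def by (intro nn_integral_eq_integral L2_sq_integrable[OF assms]) simp
  then show ?thesis by (simp add: L2_norm_def)
qed

lemma L2_sq_set_integrable: "f \<in> L2 \<Longrightarrow> set_integrable lborel {a..b} (\<lambda>x. (f x)\<^sup>2)"
  unfolding set_integrable_def by (rule integrable_mult_indicator[OF _ L2_sq_integrable]) auto

lemma L2_sq_integrable_on: "f \<in> L2 \<Longrightarrow> (\<lambda>x. (f x)\<^sup>2) integrable_on {a..b}"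
  by (rule set_borel_integral_eq_integral(1)[OF L2_sq_set_integrable])

lemma ennreal_integral_sq:
  assumes "f \<in> L2"
  shows "ennreal (integral {a..b} (\<lambda>x. (f x)\<^sup>2))
      = (\<integral>\<^sup>+x. indicator {a..b} x * ennreal ((f x)\<^sup>2) \<partial>lborel)"
proof -
  have int: "set_integrable lborel {a..b} (\<lambda>x. (f x)\<^sup>2)"
    by (rule L2_sq_set_integrable[OF assms])
  have "(\<integral>\<^sup>+x. indicator {a..b} x * ennreal ((f x)\<^sup>2) \<partial>lborel)
      = (\<integral>\<^sup>+x. ennreal (indicator {a..b} x *\<^sub>R (f x)\<^sup>2) \<partial>lborel)"
    by (intro nn_integral_cong) (simp split: split_indicator)
  also have "\<dots> = ennreal (LINT x|lborel. indicator {a..b} x *\<^sub>R (f x)\<^sup>2)"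
    using int by (intro nn_integral_eq_integral) (simp_all add: set_integrable_def)
  also have "(LINT x|lborel. indicator {a..b} x *\<^sub>R (f x)\<^sup>2) = integral {a..b} (\<lambda>x. (f x)\<^sup>2)"
    using set_borel_integral_eq_integral(2)[OF int] by (simp add: set_lebesgue_integral_def)
  finally show ?thesis by simp
qed

lemma integral_abs_sq_le:
  assumes "f \<in> L2" "0 < h"
  shows "(integral {x..x + h} (\<lambda>t. \<bar>f t\<bar>))\<^sup>2 \<le> h * integral {x..x + h} (\<lambda>t. (f t)\<^sup>2)"
proof -
  define I where "I = integral {x..x + h} (\<lambda>t. \<bar>f t\<bar>)"
  \<comment> \<open>The mean of \<open>\<bar>f\<bar>\<close> on the window; nonnegativity of the
    integral of \<open>(\<bar>f\<bar> - m)^2\<close> is the Cauchy-Schwarz inequality.\<close>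
  define m where "m = I / h"
  have i1: "(\<lambda>t. \<bar>f t\<bar>) integrable_on {x..x + h}" by (intro L2_integrable_on L2_abs assms)
  have i2: "(\<lambda>t. (f t)\<^sup>2) integrable_on {x..x + h}" by (intro L2_sq_integrable_on assms)
  have "((\<lambda>t. (f t)\<^sup>2 - 2 * m * \<bar>f t\<bar> + m\<^sup>2) has_integral
      (integral {x..x + h} (\<lambda>t. (f t)\<^sup>2) - 2 * m * I + h * m\<^sup>2)) {x..x + h}"
    unfolding I_def using assms(2) has_integral_const_real[of "m\<^sup>2" x "x + h"]
    by (intro has_integral_add has_integral_diff has_integral_mult_right integrable_integral i1 i2) simp
  moreover have "0 \<le> (f t)\<^sup>2 - 2 * m * \<bar>f t\<bar> + m\<^sup>2" for t
    using zero_le_power2[of "\<bar>f t\<bar> - m"] by (simp add: power2_diff mult_ac)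
  ultimately have "0 \<le> integral {x..x + h} (\<lambda>t. (f t)\<^sup>2) - 2 * m * I + h * m\<^sup>2"
    by (rule has_integral_nonneg)
  also have "\<dots> = integral {x..x + h} (\<lambda>t. (f t)\<^sup>2) - I\<^sup>2 / h"
    using assms(2) by (simp add: m_def field_simps power2_eq_square)
  finally show ?thesis using assms(2) by (simp add: I_def field_simps)
qed

text \<open>Cauchy-Schwarz on the window gives one factor \<open>h\<close>. Exchanging the integrals
  gives the other: \<open>t\<close> lies in \<open>[x, x + h]\<close> exactly when \<open>x\<close>
  lies in \<open>[t - h, t]\<close>, an interval of length \<open>h\<close>.\<close>

lemma sq_mass_shift_diff_le:
  assumes w: "weak_deriv 1 f g" and L2: "f \<in> L2" "g \<in> L2" and "0 < h"
  shows "sq_mass (shift_diff h f) \<le> ennreal (h\<^sup>2) * sq_mass g"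
proof -
  have [measurable]: "g \<in> borel_measurable borel" by (rule L2_measurable[OF L2(2)])
  have "sq_mass (shift_diff h f) \<le> (\<integral>\<^sup>+x. ennreal h * (\<integral>\<^sup>+t. indicator {x..x + h} t
      * ennreal ((g t)\<^sup>2) \<partial>lborel) \<partial>lborel)"
    unfolding sq_mass_def
  proof (rule nn_integral_mono_AE)
    show "AE x in lborel. ennreal ((shift_diff h f x)\<^sup>2)
        \<le> ennreal h * (\<integral>\<^sup>+t. indicator {x..x + h} t * ennreal ((g t)\<^sup>2) \<partial>lborel)"
      using AE_shift_diff_le[OF assms]
    proof (rule eventually_mono)
      fix x assume "\<bar>shift_diff h f x\<bar> \<le> integral {x..x + h} (\<lambda>x. \<bar>g x\<bar>)"
      then have "\<bar>shift_diff h f x\<bar>\<^sup>2 \<le> (integral {x..x + h} (\<lambda>x. \<bar>g x\<bar>))\<^sup>2"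
        by (rule power_mono) simp
      also have "\<dots> \<le> h * integral {x..x + h} (\<lambda>t. (g t)\<^sup>2)"
        by (rule integral_abs_sq_le[OF L2(2) \<open>0 < h\<close>])
      finally have "ennreal ((shift_diff h f x)\<^sup>2) \<le> ennreal (h * integral {x..x + h} (\<lambda>t. (g t)\<^sup>2))"
        by (intro ennreal_leI) simp
      also have "\<dots> = ennreal h * ennreal (integral {x..x + h} (\<lambda>t. (g t)\<^sup>2))"
        using \<open>0 < h\<close> by (intro ennreal_mult integral_nonneg L2_sq_integrable_on L2) auto
      finally show "ennreal ((shift_diff h f x)\<^sup>2)
          \<le> ennreal h * (\<integral>\<^sup>+t. indicator {x..x + h} t * ennreal ((g t)\<^sup>2) \<partial>lborel)"
        by (simp add: ennreal_integral_sq[OF L2(2)])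
    qed
  qed
  also have "\<dots> = ennreal h * (\<integral>\<^sup>+x. \<integral>\<^sup>+t. indicator {t - h..t} x * ennreal ((g t)\<^sup>2) \<partial>lborel \<partial>lborel)"
  proof -
    have "indicator {x..x + h} t = (indicator {t - h..t} x :: ennreal)" for x t
      by (auto simp: indicator_def)
    moreover have "(\<lambda>x. \<integral>\<^sup>+t. indicator {t - h..t} x
        * ennreal ((g t)\<^sup>2) \<partial>lborel) \<in> borel_measurable lborel"
      unfolding indicator_def of_bool_def atLeastAtMost_iff by measurable
    ultimately show ?thesis by (simp add: nn_integral_cmult)
  qed
  also have "(\<integral>\<^sup>+x. \<integral>\<^sup>+t. indicator {t - h..t} x * ennreal ((g t)\<^sup>2) \<partial>lborel \<partial>lborel)
      = (\<integral>\<^sup>+t. \<integral>\<^sup>+x. indicator {t - h..t} x * ennreal ((g t)\<^sup>2) \<partial>lborel \<partial>lborel)"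
    by (rule lborel_pair.Fubini') (unfold indicator_def of_bool_def atLeastAtMost_iff
        case_prod_beta, measurable)
  also have "\<dots> = (\<integral>\<^sup>+t. ennreal h * ennreal ((g t)\<^sup>2) \<partial>lborel)"
    using \<open>0 < h\<close> by (simp add: nn_integral_multc)
  also have "\<dots> = ennreal h * sq_mass g"
    unfolding sq_mass_def by (rule nn_integral_cmult) simp
  finally show ?thesis
    using \<open>0 < h\<close> by (simp add: power2_eq_square ennreal_mult mult.assoc)
qed

lemma L2_shift_diff_pow: "f \<in> L2 \<Longrightarrow> (shift_diff h ^^ n) f \<in> L2"
  by (induction n) (auto intro: L2_shift_diff)

lemma weak_deriv_shift_diff_pow:
  assumes "weak_deriv 1 f g" "f \<in> L2" "g \<in> L2"
  shows "weak_deriv 1 ((shift_diff h ^^ n) f) ((shift_diff h ^^ n) g)"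
  by (induction n) (use assms in \<open>auto intro: weak_deriv_shift_diff[unfolded One_nat_def]
      L2_shift_diff_pow\<close>)

text \<open>Weak derivatives commute with differences, so the outermost difference is traded for one
  derivative of the remaining ones; the induction then continues with the chain \<open>g\<close>
  moved on by one.\<close>

lemma sq_mass_shift_diff_pow_le:
  assumes "0 < h" "\<And>k. k \<le> n \<Longrightarrow> g k \<in> L2" "\<And>k. k < n \<Longrightarrow> weak_deriv 1 (g k) (g (Suc k))"
  shows "sq_mass ((shift_diff h ^^ n) (g 0)) \<le> ennreal (h ^ (2 * n)) * sq_mass (g n)"
  using assms(2,3)
proof (induction n arbitrary: g)
  case (Suc n)
  have "sq_mass ((shift_diff h ^^ Suc n) (g 0))
      = sq_mass (shift_diff h ((shift_diff h ^^ n) (g 0)))" by simp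
  also have "\<dots> \<le> ennreal (h\<^sup>2) * sq_mass ((shift_diff h ^^ n) (g (Suc 0)))"
    using Suc.prems \<open>0 < h\<close>
    by (intro sq_mass_shift_diff_le weak_deriv_shift_diff_pow L2_shift_diff_pow) auto
  also have "\<dots> \<le> ennreal (h\<^sup>2) * (ennreal (h ^ (2 * n)) * sq_mass (g (Suc n)))"
    using Suc.IH[of "\<lambda>k. g (Suc k)"] Suc.prems by (intro mult_left_mono) auto
  also have "\<dots> = ennreal (h ^ (2 * Suc n)) * sq_mass (g (Suc n))"
    using \<open>0 < h\<close> by (simp add: ennreal_mult[symmetric] mult.assoc[symmetric] power2_eq_square)
  finally show ?case .
qed simp

subsection \<open>Sampling\<close>

definition sample :: "real \<Rightarrow> real \<Rightarrow> (real \<Rightarrow> real) \<Rightarrow> int \<Rightarrow> real" where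
  "sample x h f k = f (x + h * real_of_int k)"

lemma fdiff_sample: "fdiff (\<lambda>k. sample x h f (k - c)) = (\<lambda>k. sample x h (shift_diff h f) (k - c))"
  by (simp add: fun_eq_iff fdiff_def sample_def shift_diff_def algebra_simps)

text \<open>The centred second difference is the twofold forward difference read one node to the
  left, hence the offset \<open>c + 1\<close>.\<close>

lemma laplace_sample:
  "laplace (\<lambda>k. sample x h f (k - c)) = (\<lambda>k. sample x h (shift_diff h (shift_diff h f)) (k - (c + 1)))"
  by (simp add: fun_eq_iff laplace_def sample_def shift_diff_def algebra_simps)

lemma laplace_pow_sample:
  "(laplace ^^ m) (sample x h f) = (\<lambda>k. sample x h ((shift_diff h ^^ (2 * m)) f) (k - int m))"
proof (induction m)
  case (Suc m)
  then show ?case by (simp add: laplace_sample add.commute)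
qed simp

text \<open>For either parity \<open>diff_op n\<close> is the \<open>n\<close>-fold forward
  difference up to a translation of the index, and translations do not change the sum of
  squares.\<close>

lemma diff_op_sample:
  "diff_op n (sample x h f) = (\<lambda>k. sample x h ((shift_diff h ^^ n) f) (k - int (n div 2)))"
proof (cases "even n")
  case True
  then show ?thesis by (simp add: diff_op_def laplace_pow_sample)
next
  case False
  then obtain m where "n = Suc (2 * m)" by (auto elim!: oddE)
  then show ?thesis by (simp add: diff_op_def laplace_pow_sample fdiff_sample)
qed

text \<open>The bridge from counting-measure integrals, which can be exchanged with integrals over
  the line, to the sums behind \<open>l2\<close> and \<open>ip\<close>.\<close>

lemma nn_integral_count_space_sq:
  fixes u :: "int \<Rightarrow> real"
  assumes "(\<integral>\<^sup>+k. ennreal ((u k)\<^sup>2) \<partial>count_space UNIV) < \<infinity>"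
  shows "u \<in> l2" "(\<integral>\<^sup>+k. ennreal ((u k)\<^sup>2) \<partial>count_space UNIV) = ennreal (ip u u)"
proof -
  have int: "integrable (count_space UNIV) (\<lambda>k. (u k)\<^sup>2)"
    using assms by (intro integrableI_nonneg) auto
  then have s: "(\<lambda>k. norm ((u k)\<^sup>2)) summable_on UNIV"
    unfolding abs_summable_equivalent by (simp add: Infinite_Set_Sum.abs_summable_on_def)
  then show "u \<in> l2" by (simp add: l2_def)
  have "(\<integral>\<^sup>+k. ennreal ((u k)\<^sup>2) \<partial>count_space UNIV) = ennreal (infsetsum (\<lambda>k. (u k)\<^sup>2) UNIV)"
    unfolding infsetsum_def using int by (intro nn_integral_eq_integral) auto
  also have "infsetsum (\<lambda>k. (u k)\<^sup>2) UNIV = (\<Sum>\<^sub>\<infinity>k. (u k)\<^sup>2)"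
    by (rule infsetsum_infsum[OF s[unfolded abs_summable_equivalent]])
  finally show "(\<integral>\<^sup>+k. ennreal ((u k)\<^sup>2) \<partial>count_space UNIV) = ennreal (ip u u)"
    by (simp add: ip_def power2_eq_square)
qed

lemma nn_integral_count_space_shift:
  fixes F :: "int \<Rightarrow> ennreal"
  shows "(\<integral>\<^sup>+k. F (k - c) \<partial>count_space UNIV) = (\<integral>\<^sup>+k. F k \<partial>count_space UNIV)"
  by (rule nn_integral_bij_count_space) (auto intro!: bij_betwI[where g="\<lambda>k. k + c"])

text \<open>The extended values let the bound hold at every \<open>x\<close>, so it can be
  integrated over a window without first discarding points with badly behaved samples.\<close>

lemma sample_quadratic_ineq:
  assumes "\<mu> > 0"
  shows "ennreal ((f x)\<^sup>2) \<le> ennreal (Ig n \<mu> / pi) *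
     (ennreal \<mu> * (\<integral>\<^sup>+k. ennreal ((f (x + h * real_of_int k))\<^sup>2) \<partial>count_space UNIV)
      + (\<integral>\<^sup>+k. ennreal (((shift_diff h ^^ n) f (x + h * real_of_int k))\<^sup>2) \<partial>count_space UNIV))"
    (is "_ \<le> ennreal ?c * (ennreal \<mu> * ?A + ?B)")
proof (cases "?A < \<infinity>")
  case True
  have c: "?c > 0" using Ig_pos[OF assms] by simp
  have u: "sample x h f \<in> l2" "?A = ennreal (ip (sample x h f) (sample x h f))"
    using nn_integral_count_space_sq[of "sample x h f"] True by (auto simp: sample_def)
  define d where "d = diff_op n (sample x h f)"
  have d: "d \<in> l2" unfolding d_def by (intro l2_diff_op u)
  have "?B = (\<integral>\<^sup>+k. ennreal ((d k)\<^sup>2) \<partial>count_space UNIV)"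
    unfolding d_def diff_op_sample
    using nn_integral_count_space_shift[of "\<lambda>k. ennreal ((sample x h ((shift_diff h ^^ n) f) k)\<^sup>2)"
        "int (n div 2)"]
    by (simp add: sample_def)
  also have "\<dots> = ennreal (ip d d)"
  proof (rule nn_integral_count_space_sq(2))
    have "(\<lambda>k. norm ((d k)\<^sup>2)) summable_on UNIV" using d by (simp add: l2_def)
    then have "integrable (count_space UNIV) (\<lambda>k. (d k)\<^sup>2)"
      using abs_summable_equivalent[of "\<lambda>k. (d k)\<^sup>2" UNIV]
          by (simp add: Infinite_Set_Sum.abs_summable_on_def)
    then show "(\<integral>\<^sup>+k. ennreal ((d k)\<^sup>2) \<partial>count_space UNIV) < \<infinity>"
      by (simp add: integrable_iff_bounded)
  qed
  finally have B: "?B = ennreal (ip d d)" .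
  have "(f x)\<^sup>2 \<le> ?c * (\<mu> * ip (sample x h f) (sample x h f) + ip d d)"
    using discrete_quadratic_ineq[OF assms u(1), of n] by (simp add: d_def sample_def)
  then have "ennreal ((f x)\<^sup>2) \<le> ennreal (?c * (\<mu> * ip (sample x h f) (sample x h f) + ip d d))"
    by (rule ennreal_leI)
  also have "\<dots> = ennreal ?c * (ennreal \<mu> * ?A + ?B)"
    unfolding u(2) B using c assms
    by (simp only: ennreal_mult ennreal_plus ip_self_nonneg mult_nonneg_nonneg add_nonneg_nonneg
        less_imp_le)
  finally show ?thesis .
next
  \<comment> \<open>Samples that are not square summable: both coefficients are positive, so the
    right side is infinite.\<close>
  case False
  have "ennreal ?c * (ennreal \<mu> * ?A + ?B) = \<infinity>"
    using False assms Ig_pos[OF assms, of n] by (simp add: ennreal_mult_eq_top_iff not_less top_unique)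
  then show ?thesis by simp
qed

text \<open>The translates of the half-open window by multiples of \<open>h\<close> partition the
  line; the tile containing \<open>x\<close> has index the floor of
  \<open>(x - y) / h\<close>.\<close>

lemma nn_integral_tiling:
  fixes F :: "real \<Rightarrow> ennreal"
  assumes [measurable]: "F \<in> borel_measurable borel" and "0 < h"
  shows "(\<integral>\<^sup>+x. indicator {y..<y + h} x * (\<integral>\<^sup>+k. F (x + h * real_of_int k) \<partial>count_space UNIV) \<partial>lborel)
       = (\<integral>\<^sup>+x. F x \<partial>lborel)"
proof -
  have "(\<integral>\<^sup>+x. indicator {y..<y + h} x * (\<integral>\<^sup>+k. F (x + h * real_of_int k) \<partial>count_space UNIV) \<partial>lborel)
      = (\<integral>\<^sup>+x. (\<integral>\<^sup>+k. indicator {y..<y + h} x * F (x + h * real_of_int k) \<partial>count_space UNIV) \<partial>lborel)"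
    by (simp add: nn_integral_cmult)
  also have "\<dots> = (\<integral>\<^sup>+k. (\<integral>\<^sup>+x. indicator {y..<y + h} x * F (x + h
      * real_of_int k) \<partial>lborel) \<partial>count_space UNIV)"
    by (rule nn_integral_count_space_nn_integral) auto
  also have "\<dots> = (\<integral>\<^sup>+k. (\<integral>\<^sup>+x. indicator {y..<y + h} (x - h * real_of_int k)
      * F x \<partial>lborel) \<partial>count_space UNIV)"
  proof (rule nn_integral_cong)
    fix k :: int
    show "(\<integral>\<^sup>+x. indicator {y..<y + h} x * F (x + h * real_of_int k) \<partial>lborel)
        = (\<integral>\<^sup>+x. indicator {y..<y + h} (x - h * real_of_int k) * F x \<partial>lborel)"
      using nn_integral_real_affine[of "\<lambda>x. indicator {y..<y + h} (x - h * real_of_int k)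
          * F x" 1 "h * real_of_int k"]
      by (simp add: add.commute)
  qed
  also have "\<dots> = (\<integral>\<^sup>+x. (\<integral>\<^sup>+k. indicator {y..<y + h} (x - h * real_of_int k)
      * F x \<partial>count_space UNIV) \<partial>lborel)"
    by (rule nn_integral_count_space_nn_integral[symmetric]) auto
  also have "\<dots> = (\<integral>\<^sup>+x. F x \<partial>lborel)"
  proof (rule nn_integral_cong)
    fix x
    have "x - h * real_of_int k \<in> {y..<y + h} \<longleftrightarrow> k = \<lfloor>(x - y) / h\<rfloor>" for k
      unfolding eq_commute[of k] floor_eq_iff using \<open>0 < h\<close> by (auto simp: field_simps)
    then have "(indicator {y..<y + h} (x - h * real_of_int k) :: ennreal)
        = indicator {\<lfloor>(x - y) / h\<rfloor>} k" for k
      by (simp add: indicator_def)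
    then show "(\<integral>\<^sup>+k. indicator {y..<y + h} (x - h * real_of_int k) * F x \<partial>count_space UNIV) = F x"
      by (simp add: nn_integral_multc)
  qed
  finally show ?thesis .
qed

subsection \<open>From the discrete to the continuous inequality\<close>

lemma integral_sq_window_le:
  assumes "0 < h" "\<mu> > 0" "f \<in> L2" and B: "0 \<le> B" "sq_mass ((shift_diff h ^^ n) f) \<le> ennreal B"
  shows "integral {y..y + h} (\<lambda>x. (f x)\<^sup>2) \<le> Ig n \<mu> / pi * (\<mu> * (L2_norm f)\<^sup>2 + B)"
proof -
  define c where "c = Ig n \<mu> / pi"
  have c: "c > 0" using Ig_pos[OF \<open>\<mu> > 0\<close>] by (simp add: c_def)
  define d where "d = (shift_diff h ^^ n) f"
  have [measurable]: "f \<in> borel_measurable borel" "d \<in> borel_measurable borel"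
    using assms by (auto simp: d_def intro: L2_measurable L2_shift_diff_pow)
  define F where "F x = ennreal c * (ennreal \<mu> * ennreal ((f x)\<^sup>2) + ennreal ((d x)\<^sup>2))" for x
  have [measurable]: "F \<in> borel_measurable borel" unfolding F_def by measurable
  have "ennreal (integral {y..y + h} (\<lambda>x. (f x)\<^sup>2))
      = (\<integral>\<^sup>+x. indicator {y..y + h} x * ennreal ((f x)\<^sup>2) \<partial>lborel)"
    by (rule ennreal_integral_sq[OF assms(3)])
  also have "\<dots> = (\<integral>\<^sup>+x. indicator {y..<y + h} x * ennreal ((f x)\<^sup>2) \<partial>lborel)"
    by (intro nn_integral_cong_AE eventually_mono[OF AE_lborel_singleton[of "y + h"]])
      (auto simp: indicator_def)
  also have "\<dots> \<le> (\<integral>\<^sup>+x. indicator {y..<y + h} x * (\<integral>\<^sup>+k. F (x + h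
      * real_of_int k) \<partial>count_space UNIV) \<partial>lborel)"
  proof (intro nn_integral_mono mult_left_mono)
    fix x
    show "ennreal ((f x)\<^sup>2) \<le> (\<integral>\<^sup>+k. F (x + h * real_of_int k) \<partial>count_space UNIV)"
      unfolding F_def using sample_quadratic_ineq[OF \<open>\<mu> > 0\<close>, of f x n h]
      by (simp add: nn_integral_cmult nn_integral_add c_def d_def)
  qed simp
  also have "\<dots> = (\<integral>\<^sup>+x. F x \<partial>lborel)"
    by (rule nn_integral_tiling) (use \<open>0 < h\<close> in auto)
  also have "\<dots> = ennreal c * (ennreal \<mu> * sq_mass f + sq_mass d)"
    unfolding F_def sq_mass_def by (simp add: nn_integral_cmult nn_integral_add)
  also have "\<dots> \<le> ennreal c * (ennreal \<mu> * ennreal ((L2_norm f)\<^sup>2) + ennreal B)"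
    using B(2) unfolding sq_mass_L2[OF assms(3)] d_def by (intro mult_left_mono add_left_mono) auto
  also have "\<dots> = ennreal (c * (\<mu> * (L2_norm f)\<^sup>2 + B))"
    using c \<open>\<mu> > 0\<close> B(1)
    by (simp only: ennreal_mult ennreal_plus mult_nonneg_nonneg add_nonneg_nonneg less_imp_le
        zero_le_power2)
  finally show ?thesis
    using c \<open>\<mu> > 0\<close> B(1) unfolding c_def[symmetric]
    by (subst (asm) ennreal_le_iff) (auto intro!: mult_nonneg_nonneg add_nonneg_nonneg)
qed

lemma H_chain:
  assumes "n \<ge> 1" "f \<in> H n" "g \<in> L2" "weak_deriv n f g"
  obtains G where "G 0 = f" "G n = g" "\<And>k. k \<le> n \<Longrightarrow> G k \<in> L2" "\<And>k. k < n \<Longrightarrow> weak_deriv 1 (G k) (G (Suc k))"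
proof -
  have "\<forall>k. \<exists>g. k \<le> n \<longrightarrow> g \<in> L2 \<and> weak_deriv k f g" and f: "f \<in> L2"
    using assms(2) by (auto simp: H_def)
  then obtain G0 where G0: "\<And>k. k \<le> n \<Longrightarrow> G0 k \<in> L2 \<and> weak_deriv k f (G0 k)"
    by metis
  \<comment> \<open>\<open>H n\<close> only supplies some representative of each derivative. The two
    ends of the chain are overwritten by the given \<open>f\<close> and \<open>g\<close>, which is
    consistent because \<open>n >= 1\<close>.\<close>
  define G where "G k = (if k = 0 then f else if k = n then g else G0 k)" for k
  have G: "G k \<in> L2" "weak_deriv k f (G k)" if "k \<le> n" for k
    using G0[OF that] assms f by (auto simp: G_def weak_deriv_def)
  show ?thesis
  proof
    show "G 0 = f" "G n = g" using assms(1) by (auto simp: G_def)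
    show "G k \<in> L2" if "k \<le> n" for k using G(1)[OF that] .
    show "weak_deriv 1 (G k) (G (Suc k))" if "k < n" for k
      using weak_deriv_chain[of k f "G k" "G (Suc k)"] G(2)[of k] G(2)[of "Suc k"] that by simp
  qed
qed

text \<open>The parameter is coupled to the step as \<open>s * h^(2n)\<close>. At the critical
  exponent both terms of the energy then scale exactly like \<open>h\<close>, which cancels the
  window length, and the coupled parameter tends to \<open>0\<close>, where \<open>V\<close> has its
  limit.\<close>

lemma AE_sq_le:
  assumes "n \<ge> 1" "f \<in> H n" "g \<in> L2" "weak_deriv n f g" "s > 0"
  shows "AE y in lborel. (f y)\<^sup>2 \<le> integral\<^sup>L lborel (limfun n) / pi *
      (s powr (1 - crit n) * (L2_norm f)\<^sup>2 + s powr (- crit n) * (L2_norm g)\<^sup>2)"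
proof -
  have f: "f \<in> L2" using assms(2) by (simp add: H_def)
  define A B where "A = (L2_norm f)\<^sup>2" and "B = (L2_norm g)\<^sup>2"
  define Q where "Q = s powr (1 - crit n) * A + s powr (- crit n) * B"
  obtain G where G: "G 0 = f" "G n = g" "\<And>k. k \<le> n \<Longrightarrow> G k \<in> L2" "\<And>k. k < n
      \<Longrightarrow> weak_deriv 1 (G k) (G (Suc k))"
    using H_chain[OF assms(1-4)] by metis
  have window: "integral {y..y + h} (\<lambda>x. (f x)\<^sup>2) / h
      \<le> V n (crit n) (s * h ^ (2 * n)) / pi * Q" if "h > 0" for h y
  proof -
    define m where "m = h ^ (2 * n)"
    have m: "m > 0" using that by (simp add: m_def)
    have "sq_mass ((shift_diff h ^^ n) f) \<le> ennreal m * sq_mass g"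
      using sq_mass_shift_diff_pow_le[of h n G] that G by (simp add: m_def)
    also have "\<dots> = ennreal (m * B)"
      using m by (simp add: sq_mass_L2[OF assms(3)] B_def ennreal_mult)
    finally have "integral {y..y + h} (\<lambda>x. (f x)\<^sup>2) \<le> Ig n (s * m) * (s * m * A + m * B) / pi"
      using integral_sq_window_le[of h "s * m" f "m * B" n y] that m \<open>s > 0\<close> f by (simp add: A_def B_def)
    also have "Ig n (s * m) * (s * m * A + m * B)
        = V n (crit n) (s * m) * ((s * m) powr (1 - crit n) * A + (s * m) powr (- crit n) * (m * B))"
      using m \<open>s > 0\<close> by (intro V_quadratic) simp
    also have "(s * m) powr (1 - crit n) * A + (s * m) powr (- crit n) * (m * B) = h * Q"
    proof -
      have "m powr (1 - crit n) = h"
        using that assms(1) by (simp add: m_def crit_def powr_powr flip: powr_realpow)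
      moreover from this have "m powr (- crit n) * m = h"
        using m by (simp add: powr_diff powr_minus field_simps)
      ultimately show ?thesis
        using m \<open>s > 0\<close> by (simp add: Q_def powr_mult algebra_simps)
    qed
    finally show ?thesis using that by (simp add: m_def field_simps)
  qed
  have "filterlim (\<lambda>h. s * h ^ (2 * n)) (at_right 0) (at_right 0)"
    unfolding filterlim_at
  proof
    show "\<forall>\<^sub>F h in at_right 0. s * h ^ (2 * n) \<in> {0<..} \<and> s * h ^ (2 * n) \<noteq> 0"
      using \<open>s > 0\<close> by (auto intro!: eventually_mono[OF eventually_at_right_less])
    have "((\<lambda>h. s * h ^ (2 * n)) \<longlongrightarrow> s * 0 ^ (2 * n)) (at_right 0)"
      by (intro tendsto_intros)
    then show "((\<lambda>h. s * h ^ (2 * n)) \<longlongrightarrow> 0) (at_right 0)"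
      using assms(1) by (simp add: power_0_left)
  qed
  then have "((\<lambda>h. V n (crit n) (s * h ^ (2 * n))) \<longlongrightarrow> integral\<^sup>L lborel (limfun n)) (at_right 0)"
    by (rule filterlim_compose[OF V_crit_limit[OF assms(1)]])
  then have lim: "((\<lambda>h. V n (crit n) (s * h ^ (2 * n)) / pi * Q)
      \<longlongrightarrow> integral\<^sup>L lborel (limfun n) / pi * Q) (at_right 0)"
    by (intro tendsto_intros) auto
  have "(f y)\<^sup>2 \<le> integral\<^sup>L lborel (limfun n) / pi * Q"
    if "((\<lambda>h. integral {y..y + h} (\<lambda>x. (f x)\<^sup>2) / h) \<longlongrightarrow> (f y)\<^sup>2) (at_right 0)" for y
    by (rule tendsto_le[OF _ lim that])
      (auto intro!: eventually_mono[OF eventually_at_right_less[of 0]] window simp del: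
          times_divide_eq_left)
  then show ?thesis
    using AE_lebesgue_point[OF L2_sq_integrable_on[OF f]]
    by (auto simp: Q_def A_def B_def elim: eventually_mono)
qed

lemma crit_bounds:
  assumes "n \<ge> 1"
  shows "0 < crit n" "crit n < 1"
  using assms by (auto simp: crit_def field_simps)

lemma continuous_ineq_crit:
  assumes "n \<ge> 1"
  shows "continuous_ineq n (crit n) (Kfac (crit n) * integral\<^sup>L lborel (limfun n))"
  unfolding continuous_ineq_def
proof (intro ballI impI)
  fix f g assume f: "f \<in> H n" and g: "g \<in> L2" "weak_deriv n f g"
  let ?L = "integral\<^sup>L lborel (limfun n)" and ?\<theta> = "crit n"
  let ?E = "esssup lborel (\<lambda>x. ereal \<bar>f x\<bar>)"
  define M where "M s = ?L / pi * (s powr (1 - ?\<theta>) * (L2_norm f)\<^sup>2 + s powr (- ?\<theta>)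
      * (L2_norm g)\<^sup>2)" for s
  have [measurable]: "f \<in> borel_measurable borel" using f by (auto simp: H_def intro: L2_measurable)
  \<comment> \<open>Excludes the value minus infinity; the constant \<open>0\<close> has essential
    supremum \<open>0\<close> because \<open>lborel\<close> is not the null measure.\<close>
  have E0: "0 \<le> ?E"
  proof -
    have "esssup lborel (\<lambda>x::real. 0 :: ereal) \<le> ?E" by (intro esssup_mono) auto
    then show ?thesis by (subst (asm) esssup_const) auto
  qed
  have EM: "?E \<le> ereal (sqrt (M s))" if "s > 0" for s
  proof (rule esssup_I)
    have "AE y in lborel. (f y)\<^sup>2 \<le> M s"
      unfolding M_def by (rule AE_sq_le[OF assms f g that])
    then show "AE y in lborel. ereal \<bar>f y\<bar> \<le> ereal (sqrt (M s))"
      by (rule eventually_mono) (simp add: real_le_rsqrt)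
  qed simp
  \<comment> \<open>A single scale already shows that the essential supremum is finite, so
    \<open>optimise_scale\<close> can be applied to the square of a real number.\<close>
  from E0 EM[of 1] obtain r where r: "?E = ereal r" "0 \<le> r"
    by (cases ?E) auto
  have "r\<^sup>2 \<le> M s" if "s > 0" for s
  proof -
    have "r \<le> sqrt (M s)" using EM[OF that] r by simp
    then show ?thesis using r(2)
      by (metis abs_of_nonneg real_sqrt_abs real_sqrt_le_iff)
  qed
  then have "r\<^sup>2 \<le> ?L / pi / (rpow ?\<theta> ?\<theta> * rpow (1 - ?\<theta>) (1 - ?\<theta>)) * rpow ((L2_norm f)\<^sup>2) ?\<theta>
      * rpow ((L2_norm g)\<^sup>2) (1 - ?\<theta>)"
    using crit_bounds[OF assms] unfolding M_def by (intro optimise_scale) auto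
  moreover have "rpow ((L2_norm k)\<^sup>2) a = rpow (L2_norm k) (2 * a)" for k a
    using rpow_sqrt[of "(L2_norm k)\<^sup>2" a] by (simp add: L2_norm_def)
  ultimately have "r\<^sup>2 \<le> Kfac ?\<theta> * ?L * rpow (L2_norm f) (2 * ?\<theta>) * rpow (L2_norm g) (2 * (1 - ?\<theta>))"
    by (simp add: Kfac_def mult_ac)
  then show "?E\<^sup>2 \<le> ereal (Kfac ?\<theta> * ?L * rpow (L2_norm f) (2 * ?\<theta>) * rpow (L2_norm g) (2 * (1 - ?\<theta>)))"
    using r by (simp add: power2_eq_square)
qed

text \<open>For \<open>\<theta> < 1\<close> finite limits at both ends bound \<open>V\<close>. At
  \<open>\<theta> = 1\<close> the supremum is \<open>pi\<close>, and the constant becomes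
  \<open>1\<close>, the case of \<open>discrete_ineq_1\<close>.\<close>

lemma V_bdd_and_discrete_ineq:
  assumes "n \<ge> 1" "crit n \<le> \<theta>" "\<theta> \<le> 1"
  shows "bdd_above (V n \<theta> ` {0<..})" "discrete_ineq n \<theta> (Kfac \<theta> * (SUP \<mu>\<in>{0<..}. V n \<theta> \<mu>))"
proof -
  have "bdd_above (V n \<theta> ` {0<..}) \<and> discrete_ineq n \<theta> (Kfac \<theta> * (SUP \<mu>\<in>{0<..}. V n \<theta> \<mu>))"
  proof (cases "\<theta> = 1")
    case True
    have "(SUP \<mu>\<in>{0<..}. V n 1 \<mu>) = pi" "bdd_above (V n 1 ` {0<..})"
      by (rule SUP_eq_limit[OF V_1_le V_1_at_top]; simp add: eventually_gt_at_top)+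
    then show ?thesis using discrete_ineq_1 True by (simp add: Kfac_def rpow_def)
  next
    case False
    then have \<theta>: "0 < \<theta>" "\<theta> < 1" using assms crit_bounds(1)[OF assms(1)] by auto
    have "\<exists>l. (V n \<theta> \<longlongrightarrow> l) (at_right 0)"
      using V_crit_limit[OF assms(1)] V_zero_limit[OF assms(1)] assms(2)
      by (metis less_eq_real_def)
    then obtain l where "(V n \<theta> \<longlongrightarrow> l) (at_right 0)" ..
    then have bdd: "bdd_above (V n \<theta> ` {0<..})"
      by (rule bdd_above_half_line[OF continuous_on_V _ V_at_top[OF \<theta>(2)]])
    have "V n \<theta> \<mu> \<le> (SUP \<mu>\<in>{0<..}. V n \<theta> \<mu>)" if "\<mu> > 0" for \<mu>
      using bdd that by (intro cSUP_upper) auto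
    with bdd show ?thesis
      using discrete_ineq_upper[OF \<theta>] by blast
  qed
  then show "bdd_above (V n \<theta> ` {0<..})" "discrete_ineq n \<theta> (Kfac \<theta> * (SUP \<mu>\<in>{0<..}. V n \<theta> \<mu>))"
    by auto
qed

text \<open>The limit at infinity is \<open>0\<close>, so only the limit at \<open>0\<close> has to
  be exceeded. Above the critical exponent it is \<open>0\<close> as well; at the critical exponent
  the exclusion forces \<open>n >= 2\<close>, where \<open>V_crit_exceeds_limit\<close>
  applies.\<close>

lemma V_attains_SUP:
  assumes "n \<ge> 1" "crit n \<le> \<theta>" "\<theta> < 1" "\<not> (n = 1 \<and> \<theta> = 1 / 2)"
  shows "\<exists>\<mu>\<^sub>0>0. V n \<theta> \<mu>\<^sub>0 = (SUP \<mu>\<in>{0<..}. V n \<theta> \<mu>)"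
proof -
  obtain l m where "(V n \<theta> \<longlongrightarrow> l) (at_right 0)" "m > 0" "l < V n \<theta> m"
  proof (cases "\<theta> = crit n")
    case True
    then have "n \<ge> 2" using assms by (cases "n = 1") (auto simp: crit_def)
    then show ?thesis
      using V_crit_exceeds_limit V_crit_limit[OF assms(1)] that True by metis
  next
    case False
    then show ?thesis using that[of 0 1] V_zero_limit[OF assms(1)] V_pos assms(2) by simp
  qed
  then obtain x where x: "x > 0" "\<And>y. y > 0 \<Longrightarrow> V n \<theta> y \<le> V n \<theta> x"
    using attains_max_half_line[OF continuous_on_V _ V_at_top[OF assms(3)]] V_pos by metis
  have "(SUP \<mu>\<in>{0<..}. V n \<theta> \<mu>) = V n \<theta> x"
    by (rule cSup_eq_maximum) (use x in auto)
  then show ?thesis using x(1) by auto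
qed

text \<open>Attainment is read on the half line with its ends \<open>0\<close> and infinity
  included. For \<open>\<theta> = 1\<close> every value of \<open>V\<close> is strictly below its
  limit \<open>pi\<close> at infinity, and for \<open>n = 1\<close>, \<open>\<theta> = 1 / 2\<close>
  the function \<open>pi / sqrt (\<mu> + 4)\<close> is strictly decreasing; in these two cases the
  supremum is a limit at an end. Boundedness is asserted because a real \<open>SUP\<close> has its
  intended meaning only for bounded sets.\<close>

theorem theorem5p2:
  fixes n :: nat
  assumes "n \<ge> 1"
  shows "(\<forall>\<theta>\<in>{1 - 1 / (2 * real n)..1}.
            discrete_ineq n \<theta> (K1 n \<theta>)
          \<and> (\<forall>K. discrete_ineq n \<theta> K \<longrightarrow> K1 n \<theta> \<le> K)
          \<and> bdd_above (V n \<theta> ` {0<..})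
          \<and> K1 n \<theta> = 1 / (rpow \<theta> \<theta> * rpow (1 - \<theta>) (1 - \<theta>)) * (1 / pi) * (SUP \<mu>\<in>{0<..}. V n \<theta> \<mu>)
          \<and> (if \<theta> = 1 then (V n \<theta> \<longlongrightarrow> (SUP \<mu>\<in>{0<..}. V n \<theta> \<mu>)) at_top
             else if n = 1 \<and> \<theta> = 1 / 2 then (V n \<theta> \<longlongrightarrow> (SUP \<mu>\<in>{0<..}. V n \<theta> \<mu>)) (at_right 0)
             else (\<exists>\<mu>\<^sub>0>0. V n \<theta> \<mu>\<^sub>0 = (SUP \<mu>\<in>{0<..}. V n \<theta> \<mu>))))
       \<and> (n \<ge> 2 \<longrightarrow> C1 n (1 - 1 / (2 * real n)) < ereal (K1 n (1 - 1 / (2 * real n))))"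
proof (intro conjI ballI impI)
  fix \<theta> assume "\<theta> \<in> {1 - 1 / (2 * real n)..1}"
  then have cr: "crit n \<le> \<theta>" "\<theta> \<le> 1" and \<theta>: "0 < \<theta>"
    using crit_bounds(1)[OF assms] by (auto simp: crit_def)
  note V = V_bdd_and_discrete_ineq[OF assms cr]
  note K = K1_eq[OF \<theta> cr(2) V(2)]
  show "discrete_ineq n \<theta> (K1 n \<theta>)" using V(2) K(1) by simp
  show "\<forall>K. discrete_ineq n \<theta> K \<longrightarrow> K1 n \<theta> \<le> K" using K(2) by blast
  show "bdd_above (V n \<theta> ` {0<..})" by (rule V(1))
  show "K1 n \<theta> = 1 / (rpow \<theta> \<theta> * rpow (1 - \<theta>) (1 - \<theta>)) * (1 / pi) * (SUP \<mu>\<in>{0<..}. V n \<theta> \<mu>)"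
    using K(1) by (simp only: Kfac_def)
  consider "\<theta> = 1" | "n = 1" "\<theta> = 1 / 2" | "\<theta> < 1" "\<not> (n = 1 \<and> \<theta> = 1 / 2)"
    using cr(2) by linarith
  then show "if \<theta> = 1 then (V n \<theta> \<longlongrightarrow> (SUP \<mu>\<in>{0<..}. V n \<theta> \<mu>)) at_top
             else if n = 1 \<and> \<theta> = 1 / 2 then (V n \<theta> \<longlongrightarrow> (SUP \<mu>\<in>{0<..}. V n \<theta> \<mu>)) (at_right 0)
             else (\<exists>\<mu>\<^sub>0>0. V n \<theta> \<mu>\<^sub>0 = (SUP \<mu>\<in>{0<..}. V n \<theta> \<mu>))"
  proof cases
    case 1
    have "(SUP \<mu>\<in>{0<..}. V n 1 \<mu>) = pi"
      by (rule SUP_eq_limit(1)[OF V_1_le V_1_at_top]) (simp_all add: eventually_gt_at_top)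
    then show ?thesis using V_1_at_top 1 by simp
  next
    case 2
    have SUP: "(SUP \<mu>\<in>{0<..}. V 1 (1 / 2) \<mu>) = pi / 2"
      by (rule SUP_eq_limit(1)[OF V_first_difference_limit(2,1)]) (simp_all add:
          eventually_at_right_less)
    have "(V n \<theta> \<longlongrightarrow> (SUP \<mu>\<in>{0<..}. V n \<theta> \<mu>)) (at_right 0)"
      unfolding 2 SUP by (rule V_first_difference_limit(1))
    then show ?thesis by (simp add: 2)
  next
    case 3
    then show ?thesis using V_attains_SUP[OF assms cr(1)] by auto
  qed
next
  assume n: "n \<ge> 2"
  let ?L = "integral\<^sup>L lborel (limfun n)" and ?\<theta> = "crit n"
  have \<theta>: "0 < ?\<theta>" "?\<theta> < 1" using crit_bounds[OF assms] by auto
  note V = V_bdd_and_discrete_ineq[OF assms order_refl less_imp_le[OF \<theta>(2)]]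
  obtain \<mu> where \<mu>: "\<mu> > 0" "?L < V n ?\<theta> \<mu>"
    using V_crit_exceeds_limit[OF n] by blast
  \<comment> \<open>The chain runs through the limit of \<open>V\<close> at \<open>0\<close> and one
    larger value of \<open>V\<close>; strictness enters between these two.\<close>
  have "C1 n ?\<theta> \<le> ereal (Kfac ?\<theta> * ?L)"
    unfolding C1_def using continuous_ineq_crit[OF assms] by (intro Inf_lower) auto
  also have "\<dots> < ereal (Kfac ?\<theta> * V n ?\<theta> \<mu>)"
    using \<mu>(2) Kfac_pos[OF \<theta>(1) less_imp_le[OF \<theta>(2)]] by simp
  also have "\<dots> \<le> ereal (Kfac ?\<theta> * (SUP \<mu>\<in>{0<..}. V n ?\<theta> \<mu>))"
    using \<mu>(1) V(1) Kfac_pos[OF \<theta>(1) less_imp_le[OF \<theta>(2)]]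
    by (auto intro!: mult_left_mono cSUP_upper)
  also have "\<dots> = ereal (K1 n ?\<theta>)"
    by (simp only: K1_eq(1)[OF \<theta>(1) less_imp_le[OF \<theta>(2)] V(2)])
  finally show "C1 n (1 - 1 / (2 * real n)) < ereal (K1 n (1 - 1 / (2 * real n)))"
    by (simp only: crit_def)
qed

end
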